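(* Let $\lambda>0$, $0<\alpha\le1$, let $\{X_i\}_{i\ge1}$ be i.i.d. positive integer valued random variables with finite mean and variance, independent of $\{\hat N_\alpha(t)\}_{t\ge0}$, and let $\hat Z_\alpha(t)=\sum_{i=1}^{\hat N_\alpha(t)}X_i$, $t\ge0$. Then the state probabilities $\bar p_\alpha(m,t)=\Pr\{\hat Z_\alpha(t)=m\}$ satisfy $$\frac{\mathrm d^{2\alpha}}{\mathrm dt^{2\alpha}}\bar p_\alpha(0,t)+2\lambda\frac{\mathrm d^\alpha}{\mathrm dt^\alpha}\bar p_\alpha(0,t)=-\lambda^2\bar p_\alpha(0,t),$$ and, for every integer $m\ge1$, $$\frac{\mathrm d^{2\alpha}}{\mathrm dt^{2\alpha}}\bar p_\alpha(m,t)+2\lambda\frac{\mathrm d^\alpha}{\mathrm dt^\alpha}\bar p_\alpha(m,t)=-\lambda^2\Big(\bar p_\alpha(m,t)-\sum_{j=1}^m\Pr\{X_1=j\}\,\bar p_\alpha(m-j,t)\Big).$$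
   Context: Three-parameter Mittag-Leffler function: $E_{\alpha,\beta}^{\gamma}(x)=\frac{1}{\Gamma(\gamma)}\sum_{j=0}^\infty\frac{\Gamma(j+\gamma)x^j}{j!\,\Gamma(j\alpha+\beta)}$ for $\alpha,\beta,\gamma>0$, $x\in\mathbb R$. For $\lambda>0$ and $0<\alpha\le1$, $\{\hat N_\alpha(t)\}_{t\ge0}$ is the renewal counting process with $\hat N_\alpha(0)=0$ whose i.i.d. interarrival times have density $\lambda^2t^{2\alpha-1}E^2_{\alpha,2\alpha}(-\lambda t^\alpha)$, $t>0$. Its probability mass function is, for $n\ge0$, $$\hat p_\alpha(n,t)=\Pr\{\hat N_\alpha(t)=n\}=\lambda^{2n}t^{2n\alpha}E_{\alpha,2n\alpha+1}^{2n+1}(-\lambda t^\alpha)+\lambda^{2n+1}t^{(2n+1)\alpha}E_{\alpha,(2n+1)\alpha+1}^{2n+2}(-\lambda t^\alpha).$$ It is known (Beghin and Orsingher, 2010) that $\frac{\mathrm d^{2\alpha}}{\mathrm dt^{2\alpha}}\hat p_\alpha(n,t)+2\lambda\frac{\mathrm d^{\alpha}}{\mathrm dt^{\alpha}}\hat p_\alpha(n,t)=-\lambda^2(\hat p_\alpha(n,t)-\hat p_\alpha(n-1,t))$ for $n\ge0$, with $\hat p_\alpha(-1,t)=0$. $\frac{\mathrm d^\gamma}{\mathrm dt^\gamma}$ is the Caputo fractional derivative: for $0<\gamma<1$, $\frac{\mathrm d^\gamma}{\mathrm dt^\gamma}f(t)=\frac1{\Gamma(1-\gamma)}\int_0^t(t-s)^{-\gamma}f'(s)\,\mathrm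 ds$; for $1<\gamma<2$, $\frac{\mathrm d^\gamma}{\mathrm dt^\gamma}f(t)=\frac1{\Gamma(2-\gamma)}\int_0^t(t-s)^{1-\gamma}f''(s)\,\mathrm ds$; for $\gamma=1,2$ it is the ordinary derivative of order $\gamma$. An empty sum is $0$. *)

theory Defs
  imports "HOL-Probability.Probability"
begin

definition mittag_leffler3 :: "real \<Rightarrow> real \<Rightarrow> real \<Rightarrow> real \<Rightarrow> real" where
  "mittag_leffler3 \<alpha> \<beta> \<gamma> x =
     1 / Gamma \<gamma> * (\<Sum>j. Gamma (real j + \<gamma>) * x ^ j / (fact j * Gamma (real j * \<alpha> + \<beta>)))"

definition interarrival_density :: "real \<Rightarrow> real \<Rightarrow> real \<Rightarrow> real" where
  "interarrival_density lam \<alpha> t =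
     (if t > 0 then lam\<^sup>2 * t powr (2 * \<alpha> - 1) * mittag_leffler3 \<alpha> (2 * \<alpha>) 2 (- lam * t powr \<alpha>)
      else 0)"

text \<open>
  \<^term>\<open>T k\<close> is the \<^term>\<open>k\<close>-th interarrival time (\<^term>\<open>k \<ge> 1\<close>), so the sum in the last line is
  the time of the \<^term>\<open>n\<close>-th event. Almost surely the interarrival times are positive and only
  finitely many events occur up to any given time; hence the cardinality is almost surely that of
  a finite set, and \<^term>\<open>N 0\<close> vanishes almost surely. Nothing is said about \<^term>\<open>N t\<close> for negative
  \<^term>\<open>t\<close>.
\<close>
definition renewal_counting_process ::
  "'a measure \<Rightarrow> (real \<Rightarrow> real) \<Rightarrow> (real \<Rightarrow> 'a \<Rightarrow> nat) \<Rightarrow> bool" where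
  "renewal_counting_process M f N \<longleftrightarrow>
     (\<exists>T :: nat \<Rightarrow> 'a \<Rightarrow> real.
        prob_space.indep_vars M (\<lambda>_. borel) T {1..} \<and>
        (\<forall>k\<ge>1. distributed M lborel (T k) (\<lambda>x. ennreal (f x))) \<and>
        (AE \<omega> in M. \<forall>t\<ge>0. N t \<omega> = card {n. 1 \<le> n \<and> (\<Sum>k=1..n. T k \<omega>) \<le> t}))"

text \<open>The sigma-algebra on \<^term>\<open>space M\<close> generated by a family of integer valued maps.\<close>
definition generated_events :: "'a measure \<Rightarrow> ('i \<Rightarrow> 'a \<Rightarrow> nat) \<Rightarrow> 'i set \<Rightarrow> 'a set set" where
  "generated_events M Y I = sigma_sets (space M) {Y i -` A \<inter> space M | i A. i \<in> I}"

definition compound_process ::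
  "(real \<Rightarrow> 'a \<Rightarrow> nat) \<Rightarrow> (nat \<Rightarrow> 'a \<Rightarrow> nat) \<Rightarrow> real \<Rightarrow> 'a \<Rightarrow> nat" where
  "compound_process N X t \<omega> = (\<Sum>i=1..N t \<omega>. X i \<omega>)"

definition state_prob :: "'a measure \<Rightarrow> (real \<Rightarrow> 'a \<Rightarrow> nat) \<Rightarrow> nat \<Rightarrow> real \<Rightarrow> real" where
  "state_prob M Z m t = measure M {\<omega> \<in> space M. Z t \<omega> = m}"

text \<open>
  The Caputo derivative of order \<^term>\<open>\<gamma>\<close> at \<^term>\<open>t\<close>; only \<^term>\<open>0 < \<gamma> \<and> \<gamma> \<le> 2\<close> and \<^term>\<open>t > 0\<close>
  are meaningful. Since \<^const>\<open>deriv\<close> and the Lebesgue integral are total,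
  \<open>caputo_differentiable\<close> below records that the derivatives and the integral that occur in
  it exist.
\<close>
definition caputo_deriv :: "real \<Rightarrow> (real \<Rightarrow> real) \<Rightarrow> real \<Rightarrow> real" where
  "caputo_deriv \<gamma> f t =
     (if \<gamma> = 1 then deriv f t
      else if \<gamma> = 2 then deriv (deriv f) t
      else if \<gamma> < 1 then
        1 / Gamma (1 - \<gamma>) * (LBINT s:{0<..<t}. (t - s) powr (- \<gamma>) * deriv f s)
      else
        1 / Gamma (2 - \<gamma>) * (LBINT s:{0<..<t}. (t - s) powr (1 - \<gamma>) * deriv (deriv f) s))"

definition caputo_differentiable :: "real \<Rightarrow> (real \<Rightarrow> real) \<Rightarrow> real \<Rightarrow> bool" where
  "caputo_differentiable \<gamma> f t \<longleftrightarrow>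
     (if \<gamma> = 1 then f field_differentiable at t
      else if \<gamma> = 2 then
        (\<forall>\<^sub>F s in nhds t. f field_differentiable at s) \<and> deriv f field_differentiable at t
      else if \<gamma> < 1 then
        (\<forall>s\<in>{0<..<t}. f field_differentiable at s) \<and>
        set_integrable lborel {0<..<t} (\<lambda>s. (t - s) powr (- \<gamma>) * deriv f s)
      else
        (\<forall>s\<in>{0<..<t}. f field_differentiable at s \<and> deriv f field_differentiable at s) \<and>
        set_integrable lborel {0<..<t} (\<lambda>s. (t - s) powr (1 - \<gamma>) * deriv (deriv f) s))"

end

theory Submission
  imports Defs
begin

text \<open>
  Everything reduces to algebra with formal power series. Let \<open>k\<^sub>c(t) = t\<^bsup>c-1\<^esup> / \<Gamma>(c)\<close>, so that
  convolution on the half line adds exponents, \<open>k\<^sub>a * k\<^sub>b = k\<^bsub>a+b\<^esub>\<close>, and differentiation lowers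
  them by one. To a formal power series \<open>A\<close> with positive radius of convergence associate the
  function \<open>\<Phi>\<^sub>c(A) = (\<Sum>n. A\<^sub>n k\<^bsub>\<alpha>n+c\<^esub>)\<close>, which is \<open>frac_series\<close> below and converges on
  \<open>(0, \<infinity>)\<close>. Then convolution becomes multiplication
  (\<open>frac_series_convolution\<close>), and for \<open>f = \<Phi>\<^sub>1(A)\<close> the Caputo derivatives of orders \<open>\<alpha>\<close> and \<open>2\<alpha>\<close>
  become the removal of the first one or two coefficients of \<open>A\<close>, where for the order \<open>2\<alpha>\<close> the
  coefficient of \<open>x\<close> has to vanish (\<open>caputo_frac_series\<close>, \<open>caputo_2_frac_series\<close>). In terms of
  Laplace transforms, \<open>\<Phi>\<^sub>c(A)\<close> has the transform \<open>s\<^bsup>-c\<^esup> A(s\<^bsup>-\<alpha>\<^esup>)\<close>.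

  The interarrival density is \<open>\<Phi>\<^sub>0(\<phi>)\<close> with \<open>\<phi> = (\<lambda>x / (1 + \<lambda>x))\<^sup>2\<close>. Hence the \<open>n\<close>-th renewal time has
  density \<open>\<Phi>\<^sub>0(\<phi>\<^sup>n)\<close> and distribution function \<open>\<Phi>\<^sub>1(\<phi>\<^sup>n)\<close>, and the counting process takes the value
  \<open>n\<close> at time \<open>t\<close> with probability \<open>\<Phi>\<^sub>1((1 - \<phi>) \<phi>\<^sup>n)(t)\<close> (\<open>prob_renewal_count\<close>). As the jumps are at
  least one, only the values \<open>n \<le> m\<close> contribute to the state probability of \<open>m\<close>, which is therefore a
  finite combination \<open>\<Phi>\<^sub>1(\<Sum>n\<le>m. q\<^sub>n(m) (1 - \<phi>) \<phi>\<^sup>n)\<close> with \<open>q\<^sub>n\<close> the \<open>n\<close>-fold convolution of the jump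
  law. From \<open>(1 + \<lambda>x)\<^sup>2 \<phi> = \<lambda>\<^sup>2 x\<^sup>2\<close> the series \<open>(1 - \<phi>) \<phi>\<^sup>n\<close> satisfy the required equation with a
  shift of \<open>n\<close> on the right-hand side (\<open>telegraph_op_count_fps_0\<close>, \<open>telegraph_op_count_fps_Suc\<close>), and
  the recursion \<open>q\<^bsub>n+1\<^esub>(m) = (\<Sum>j=1..m. q\<^sub>1(j) q\<^sub>n(m - j))\<close> turns that shift into the sum over the
  first jump.

  The one analytic point is that the interarrival density is nonnegative; otherwise the extended
  nonnegative density of the interarrival times would not be the function \<open>\<Phi>\<^sub>0(\<phi>)\<close>. Here
  \<open>\<Phi>\<^sub>0(\<phi>)\<close> is the convolution square of \<open>g = \<Phi>\<^sub>0(\<lambda>x / (1 + \<lambda>x))\<close>, and \<open>g\<close> is positive because it is the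
  resolvent of the log-convex kernel \<open>\<lambda>k\<^sub>\<alpha>\<close> (\<open>relax_pos\<close>).
\<close>

section \<open>Riemann-Liouville kernels\<close>

text \<open>
  Convolution with this kernel is the Riemann-Liouville fractional integral of order \<^term>\<open>c\<close>.
  Writing it with \<^const>\<open>rGamma\<close> makes it vanish at the poles \<open>c = 0, -1, -2, \<dots>\<close> of the Gamma
  function, so that the rule "differentiation lowers the index by one" holds for every real index.
\<close>
definition rl_kernel :: "real \<Rightarrow> real \<Rightarrow> real" where
  "rl_kernel c t = t powr (c - 1) * rGamma c"

lemma rl_kernel_0 [simp]: "rl_kernel 0 t = 0"
  by (simp add: rl_kernel_def)

lemma rl_kernel_1: "t > 0 \<Longrightarrow> rl_kernel 1 t = 1"
  by (simp add: rl_kernel_def)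

lemma rl_kernel_nonneg: "c > 0 \<Longrightarrow> rl_kernel c t \<ge> 0"
  by (simp add: rl_kernel_def rGamma_inverse_Gamma Gamma_real_nonneg)

lemma rl_kernel_pos: "c > 0 \<Longrightarrow> t > 0 \<Longrightarrow> rl_kernel c t > 0"
  by (simp add: rl_kernel_def rGamma_inverse_Gamma Gamma_real_pos)

lemma has_bochner_integral_Beta:
  assumes "a > 0" "b > (0::real)"
  shows "has_bochner_integral lborel
    (\<lambda>x. indicator {0<..<1} x * (x powr (a - 1) * (1 - x) powr (b - 1))) (Beta a b)"
proof -
  have S: "set_integrable lborel {0..1} (\<lambda>t. t powr (a - 1) * (1 - t) powr (b - 1))"
    by (rule integrable_Beta[OF assms])
  have "(LINT t : {0..1} | lborel. t powr (a - 1) * (1 - t) powr (b - 1)) = Beta a b"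
    using set_borel_integral_eq_integral(2)[OF S] has_integral_Beta_real[OF assms]
    by (simp add: integral_unique)
  with S have "has_bochner_integral lborel
    (\<lambda>x. indicator {0..1} x *\<^sub>R (x powr (a - 1) * (1 - x) powr (b - 1))) (Beta a b)"
    unfolding set_integrable_def set_lebesgue_integral_def has_bochner_integral_iff by simp
  also have "(\<lambda>x::real. indicator {0..1} x *\<^sub>R (x powr (a - 1) * (1 - x) powr (b - 1))) =
      (\<lambda>x. indicator {0<..<1} x * (x powr (a - 1) * (1 - x) powr (b - 1)))"
    by (auto simp: fun_eq_iff indicator_def)
  finally show ?thesis .
qed

text \<open>
  This is the Beta integral \<open>\<Gamma>(a) \<Gamma>(b) / \<Gamma>(a + b)\<close> after rescaling \<open>[0, t]\<close> to the unit interval.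
\<close>
lemma rl_kernel_convolution:
  assumes "a > 0" "b > 0" "t > 0"
  shows "has_bochner_integral lborel
    (\<lambda>s. indicator {0<..<t} s * (rl_kernel a (t - s) * rl_kernel b s)) (rl_kernel (a + b) t)"
proof -
  have "has_bochner_integral lborel (\<lambda>s. indicator {0<..<1} (0 + 1 / t * s) *
      ((0 + 1 / t * s) powr (b - 1) * (1 - (0 + 1 / t * s)) powr (a - 1))) (Beta b a /\<^sub>R \<bar>1 / t\<bar>)"
    using has_bochner_integral_Beta[OF assms(2,1)] assms
    by (subst lborel_has_bochner_integral_real_affine_iff[symmetric]) auto
  from has_bochner_integral_mult_right[OF this, of "t powr (a + b - 2) * (rGamma a * rGamma b)"]
  have *: "has_bochner_integral lborel (\<lambda>s. t powr (a + b - 2) * (rGamma a * rGamma b) *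
      (indicator {0<..<1} (s / t) * ((s / t) powr (b - 1) * (1 - s / t) powr (a - 1))))
      (t powr (a + b - 2) * (rGamma a * rGamma b) * (Beta b a * t))"
    using assms by (simp add: mult.commute[of t "Beta b a"])
  have "Gamma a \<noteq> 0" "Gamma b \<noteq> 0" "Gamma (a + b) \<noteq> 0"
    using assms Gamma_real_pos[of a] Gamma_real_pos[of b] Gamma_real_pos[of "a + b"] by (metis add_pos_pos less_irrefl)+
  hence "t powr (a + b - 2) * (rGamma a * rGamma b) * (Beta b a * t) = t powr (a + b - 2) * t powr 1 * rGamma (a + b)"
    using assms by (simp add: Beta_def rGamma_inverse_Gamma field_simps)
  also have "t powr (a + b - 2) * t powr 1 = t powr (a + b - 1)"
    by (subst powr_add[symmetric]) (simp add: algebra_simps)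
  finally have val: "t powr (a + b - 2) * (rGamma a * rGamma b) * (Beta b a * t) = rl_kernel (a + b) t"
    by (simp add: rl_kernel_def)
  have "t powr (a + b - 2) * (rGamma a * rGamma b) *
      (indicator {0<..<1} (s / t) * ((s / t) powr (b - 1) * (1 - s / t) powr (a - 1))) =
      indicator {0<..<t} s * (rl_kernel a (t - s) * rl_kernel b s)" for s
  proof (cases "s \<in> {0<..<t}")
    case True
    have "1 - s / t = (t - s) / t" using assms by (simp add: field_simps)
    moreover have "t powr (a + b - 2) = t powr (b - 1) * t powr (a - 1)"
      by (subst powr_add[symmetric]) (simp add: algebra_simps)
    ultimately show ?thesis using True assms
      by (simp add: rl_kernel_def powr_divide field_simps)
  next
    case False
    hence "s / t \<notin> {0<..<1}" using assms by (auto simp: field_simps)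
    with False show ?thesis by simp
  qed
  with * val show ?thesis by simp
qed

text \<open>
  Keeping only the part \<open>[L, L + 1]\<close> of Euler's integral bounds the Gamma function from below by an
  exponential whose base \<open>L\<close> can be as large as desired. This is all the growth that convergence of
  the series below requires.
\<close>
lemma rGamma_real_le:
  assumes "L > 0" "x \<ge> (1::real)"
  shows "rGamma x \<le> exp (L + 1) * L powr (1 - x)"
proof -
  have "L powr (x - 1) / exp (L + 1) \<le> Gamma x"
  proof (rule has_integral_le)
    show "((\<lambda>t. indicator {0..} t * (t powr (x - 1) / exp t)) has_integral Gamma x) UNIV"
    proof -
      have "((\<lambda>t. if t \<in> {0..} then t powr (x - 1) / exp t else 0) has_integral Gamma x) UNIV"
        using Gamma_integral_real[of x] assms by (subst has_integral_restrict_UNIV) auto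
      thus ?thesis by (rule has_integral_eq[rotated]) (auto simp: indicator_def)
    qed
    have "((\<lambda>t. if t \<in> {L..L+1} then L powr (x - 1) / exp (L + 1) else 0) has_integral L powr (x - 1) / exp (L + 1)) UNIV"
      using has_integral_const_real[of "L powr (x - 1) / exp (L + 1)" L "L + 1"]
      by (subst has_integral_restrict_UNIV) auto
    thus "((\<lambda>t. indicator {L..L+1} t * (L powr (x - 1) / exp (L + 1))) has_integral L powr (x - 1) / exp (L + 1)) UNIV"
      by (rule has_integral_eq[rotated]) (auto simp: indicator_def)
    show "indicator {L..L+1} t * (L powr (x - 1) / exp (L + 1)) \<le> indicator {0..} t * (t powr (x - 1) / exp t)" for t
      using assms by (auto simp: indicator_def intro!: frac_le powr_mono2)
  qed
  hence "inverse (Gamma x) \<le> inverse (L powr (x - 1) / exp (L + 1))"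
    using assms by (intro le_imp_inverse_le) auto
  also have "\<dots> = exp (L + 1) * L powr (1 - x)"
    by (simp add: powr_minus[symmetric] divide_inverse)
  finally show ?thesis by (simp add: rGamma_inverse_Gamma)
qed

section \<open>Power series in the kernels\<close>

text \<open>
  The function with the formal Laplace transform \<open>s\<^bsup>-c\<^esup> A(s\<^bsup>-\<alpha>\<^esup>)\<close>. Mittag-Leffler functions of
  \<open>-\<lambda> t\<^sup>\<alpha>\<close>, multiplied by a power of \<open>t\<close>, are of this form with a rational \<open>A\<close>.
\<close>
definition frac_series :: "real \<Rightarrow> real \<Rightarrow> real fps \<Rightarrow> real \<Rightarrow> real" where
  "frac_series \<alpha> c A t = (\<Sum>n. fps_nth A n * rl_kernel (\<alpha> * real n + c) t)"

lemma fps_conv_radius_posD: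
  fixes A :: "real fps"
  assumes "fps_conv_radius A > 0"
  obtains C R where "C > 0" "R > 0" "\<And>n. \<bar>fps_nth A n\<bar> \<le> C * R ^ n"
proof -
  obtain r where r: "0 < ereal r" "ereal r < fps_conv_radius A"
    using ereal_dense2[OF assms] by blast
  have "summable (\<lambda>n. norm (fps_nth A n * r ^ n))"
    by (rule norm_summable_fps) (use r in auto)
  hence "bounded (range (\<lambda>n. norm (fps_nth A n * r ^ n)))"
    using convergent_imp_bounded summable_LIMSEQ_zero by blast
  then obtain C where C: "\<And>n. norm (norm (fps_nth A n * r ^ n)) \<le> C" "C > 0"
    unfolding bounded_pos by blast
  show ?thesis
  proof (rule that)
    show "C > 0" by fact
    show "inverse r > 0" using r by simp
    show "\<bar>fps_nth A n\<bar> \<le> C * inverse r ^ n" for n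
      using C(1)[of n] r by (simp add: abs_mult field_simps)
  qed
qed

text \<open>
  The coefficients grow at most geometrically, and the reciprocal Gamma function decays faster than
  every geometric sequence.
\<close>
lemma summable_rGamma_powser:
  fixes A :: "real fps"
  assumes "fps_conv_radius A > 0" "\<alpha> > 0"
  shows "summable (\<lambda>n. norm (fps_nth A n * rGamma (\<alpha> * real n + c) * y ^ n))"
proof -
  obtain C R where CR: "C > 0" "R > 0" "\<And>n. \<bar>fps_nth A n\<bar> \<le> C * R ^ n"
    using fps_conv_radius_posD[OF assms(1)] by metis
  \<comment> \<open>This \<open>L\<close> turns the majorant into a geometric series of ratio \<open>1/2\<close>.\<close>
  define L where "L = (2 * R * (\<bar>y\<bar> + 1)) powr (1 / \<alpha>)"
  have L: "L > 0" using CR by (simp add: L_def)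
  have L\<alpha>: "L powr \<alpha> = 2 * R * (\<bar>y\<bar> + 1)" using assms CR by (simp add: L_def powr_powr)
  define D where "D = C * exp (L + 1) * L powr (1 - c)"
  have "eventually (\<lambda>n. \<alpha> * real n + c \<ge> 1) sequentially"
    using assms by real_asymp
  hence "eventually (\<lambda>n. norm (norm (fps_nth A n * rGamma (\<alpha> * real n + c) * y ^ n)) \<le> D * (1 / 2) ^ n) sequentially"
  proof eventually_elim
    case (elim n)
    have "rGamma (\<alpha> * real n + c) \<ge> 0"
      using elim by (simp add: rGamma_inverse_Gamma Gamma_real_nonneg)
    hence "norm (norm (fps_nth A n * rGamma (\<alpha> * real n + c) * y ^ n)) =
      \<bar>fps_nth A n\<bar> * rGamma (\<alpha> * real n + c) * \<bar>y\<bar> ^ n"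
      by (simp add: abs_mult power_abs)
    also have "\<dots> \<le> (C * R ^ n) * (exp (L + 1) * L powr (1 - (\<alpha> * real n + c))) * (\<bar>y\<bar> + 1) ^ n"
      using CR \<open>rGamma _ \<ge> 0\<close> elim L by (intro mult_mono power_mono rGamma_real_le) auto
    also have "L powr (1 - (\<alpha> * real n + c)) = L powr (1 - c) / (L powr \<alpha>) ^ n"
    proof -
      have "(L powr \<alpha>) ^ n = L powr (\<alpha> * real n)"
        using L by (simp add: powr_powr powr_realpow[symmetric])
      thus ?thesis by (simp add: powr_diff[symmetric] algebra_simps)
    qed
    also have "(C * R ^ n) * (exp (L + 1) * (L powr (1 - c) / (L powr \<alpha>) ^ n)) * (\<bar>y\<bar> + 1) ^ n =
       D * ((R * (\<bar>y\<bar> + 1)) / (L powr \<alpha>)) ^ n"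
      by (simp add: D_def power_mult_distrib power_divide)
    also have "(R * (\<bar>y\<bar> + 1)) / (L powr \<alpha>) = 1 / 2"
    proof -
      have "R * (\<bar>y\<bar> + 1) > 0" using CR by simp
      moreover have "x / (2 * x) = 1 / 2" if "x > 0" for x :: real using that by simp
      ultimately show ?thesis unfolding L\<alpha> mult.assoc by blast
    qed
    finally show ?case .
  qed
  thus ?thesis
    by (rule summable_comparison_test_ev) (intro summable_mult summable_geometric, simp)
qed

lemma rl_kernel_power:
  assumes "t > 0"
  shows "rl_kernel (\<alpha> * real n + c) t = t powr (c - 1) * (rGamma (\<alpha> * real n + c) * (t powr \<alpha>) ^ n)"
proof -
  have "(t powr \<alpha>) ^ n = t powr (\<alpha> * real n)"
    using assms by (simp add: powr_powr powr_realpow[symmetric])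
  hence "t powr (\<alpha> * real n + c - 1) = t powr (c - 1) * (t powr \<alpha>) ^ n"
    by (simp add: powr_add[symmetric] algebra_simps)
  thus ?thesis by (simp add: rl_kernel_def)
qed

lemma frac_series_summable_norm:
  assumes "fps_conv_radius A > 0" "\<alpha> > 0" "t > 0"
  shows "summable (\<lambda>n. norm (fps_nth A n * rl_kernel (\<alpha> * real n + c) t))"
proof -
  have "summable (\<lambda>n. norm (t powr (c - 1)) * norm (fps_nth A n * rGamma (\<alpha> * real n + c) * (t powr \<alpha>) ^ n))"
    by (intro summable_mult summable_rGamma_powser assms)
  thus ?thesis using assms by (simp add: rl_kernel_power abs_mult mult_ac)
qed

lemma frac_series_sums:
  assumes "fps_conv_radius A > 0" "\<alpha> > 0" "t > 0"
  shows "(\<lambda>n. fps_nth A n * rl_kernel (\<alpha> * real n + c) t) sums frac_series \<alpha> c A t"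
  unfolding frac_series_def
  by (intro summable_sums summable_norm_cancel[OF frac_series_summable_norm] assms)

text \<open>
  Removing the leading coefficient divides \<open>A\<close> by \<open>x\<close>; the index compensates by \<open>\<alpha>\<close>. The hypothesis
  on the removed term holds when \<open>A\<close> has no constant coefficient, but also at \<open>c = 0\<close> and \<open>c = -1\<close>,
  where the kernel itself vanishes.
\<close>
lemma frac_series_shift:
  assumes "fps_conv_radius A > 0" "\<alpha> > 0" "t > 0" "fps_nth A 0 * rl_kernel c t = 0"
  shows "frac_series \<alpha> c A t = frac_series \<alpha> (c + \<alpha>) (fps_shift 1 A) t"
proof -
  have "(\<lambda>n. fps_nth A (Suc n) * rl_kernel (\<alpha> * real (Suc n) + c) t) sums
     (frac_series \<alpha> c A t - fps_nth A 0 * rl_kernel (\<alpha> * real 0 + c) t)"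
    using frac_series_sums[OF assms(1-3), of c] by (subst sums_Suc_iff) simp
  hence "(\<lambda>n. fps_nth A (Suc n) * rl_kernel (\<alpha> * real (Suc n) + c) t) sums frac_series \<alpha> c A t"
    using assms by simp
  moreover have "(\<lambda>n. fps_nth A (Suc n) * rl_kernel (\<alpha> * real (Suc n) + c) t) =
     (\<lambda>n. fps_nth (fps_shift 1 A) n * rl_kernel (\<alpha> * real n + (c + \<alpha>)) t)"
    by (simp add: algebra_simps)
  ultimately show ?thesis unfolding frac_series_def by (simp add: sums_iff)
qed

lemma frac_series_add:
  assumes "fps_conv_radius A > 0" "fps_conv_radius B > 0" "\<alpha> > 0" "t > 0"
  shows "frac_series \<alpha> c (A + B) t = frac_series \<alpha> c A t + frac_series \<alpha> c B t"
  using sums_add[OF frac_series_sums[OF assms(1,3,4), of c] frac_series_sums[OF assms(2,3,4), of c]]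
  unfolding frac_series_def by (simp add: sums_iff distrib_right)

lemma frac_series_diff:
  assumes "fps_conv_radius A > 0" "fps_conv_radius B > 0" "\<alpha> > 0" "t > 0"
  shows "frac_series \<alpha> c (A - B) t = frac_series \<alpha> c A t - frac_series \<alpha> c B t"
  using sums_diff[OF frac_series_sums[OF assms(1,3,4), of c] frac_series_sums[OF assms(2,3,4), of c]]
  unfolding frac_series_def by (simp add: sums_iff left_diff_distrib)

lemma frac_series_cmult:
  assumes "fps_conv_radius A > 0" "\<alpha> > 0" "t > 0"
  shows "frac_series \<alpha> c (fps_const k * A) t = k * frac_series \<alpha> c A t"
  using sums_mult[OF frac_series_sums[OF assms, of c], of k]
  unfolding frac_series_def by (simp add: sums_iff mult_ac)

lemma frac_series_X [simp]: "frac_series \<alpha> c fps_X t = rl_kernel (\<alpha> + c) t"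
proof -
  have "(\<lambda>n. fps_nth fps_X n * rl_kernel (\<alpha> * real n + c) t) =
        (\<lambda>n. if n = 1 then rl_kernel (\<alpha> + c) t else 0)" by auto
  thus ?thesis unfolding frac_series_def by (simp add: sums_iff[THEN iffD1, OF sums_single])
qed

lemma frac_series_1 [simp]: "frac_series \<alpha> c 1 t = rl_kernel c t"
proof -
  have "(\<lambda>n. fps_nth 1 n * rl_kernel (\<alpha> * real n + c) t) =
        (\<lambda>n. if n = 0 then rl_kernel c t else 0)" by auto
  thus ?thesis unfolding frac_series_def by (simp add: sums_iff[THEN iffD1, OF sums_single])
qed

lemma frac_series_0 [simp]: "frac_series \<alpha> c 0 t = 0"
  by (simp add: frac_series_def)

lemma fps_conv_radius_pos_add:
  "fps_conv_radius A > 0 \<Longrightarrow> fps_conv_radius B > 0 \<Longrightarrow> fps_conv_radius (A + B :: real fps) > 0"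
  using fps_conv_radius_add[of A B] by (auto simp: min_def split: if_splits)

lemma fps_conv_radius_pos_diff:
  "fps_conv_radius A > 0 \<Longrightarrow> fps_conv_radius B > 0 \<Longrightarrow> fps_conv_radius (A - B :: real fps) > 0"
  using fps_conv_radius_diff[of A B] by (auto simp: min_def split: if_splits)

lemma fps_conv_radius_pos_mult:
  "fps_conv_radius A > 0 \<Longrightarrow> fps_conv_radius B > 0 \<Longrightarrow> fps_conv_radius (A * B :: real fps) > 0"
  using fps_conv_radius_mult[of A B] by (auto simp: min_def split: if_splits)

lemma fps_conv_radius_pos_power:
  "fps_conv_radius A > 0 \<Longrightarrow> fps_conv_radius (A ^ n :: real fps) > 0"
  using fps_conv_radius_power[of A n] by (auto simp: min_def split: if_splits)

lemma fps_conv_radius_pos_sum: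
  "(\<And>i. i \<in> I \<Longrightarrow> fps_conv_radius (A i) > 0) \<Longrightarrow> fps_conv_radius (\<Sum>i\<in>I. A i :: real fps) > 0"
  by (induction I rule: infinite_finite_induct) (auto intro: fps_conv_radius_pos_add)

lemmas fps_conv_radius_pos = fps_conv_radius_pos_add fps_conv_radius_pos_diff
  fps_conv_radius_pos_mult fps_conv_radius_pos_power fps_conv_radius_pos_sum

lemma frac_series_sum:
  assumes "\<And>i. i \<in> I \<Longrightarrow> fps_conv_radius (A i) > 0" "\<alpha> > 0" "t > 0"
  shows "frac_series \<alpha> c (\<Sum>i\<in>I. A i) t = (\<Sum>i\<in>I. frac_series \<alpha> c (A i) t)"
  using assms
  by (induction I rule: infinite_finite_induct) (auto simp: frac_series_add fps_conv_radius_pos)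

text \<open>
  Multiply the two series by the Cauchy product and integrate each term with
  \<open>rl_kernel_convolution\<close>. Termwise integration is justified because the series built from the
  absolute values of the coefficients have positive radius of convergence as well, so the integrals
  of the majorants are summable. The last two hypotheses exclude the kernel of index 0, which stands
  for a Dirac mass.
\<close>
lemma frac_series_convolution:
  assumes A: "fps_conv_radius A > 0" and B: "fps_conv_radius B > 0"
    and \<alpha>: "\<alpha> > 0" and t: "t > 0" and cd: "c \<ge> 0" "d \<ge> 0"
    and c: "c > 0 \<or> fps_nth A 0 = 0" and d: "d > 0 \<or> fps_nth B 0 = 0"
  shows "has_bochner_integral lborel
    (\<lambda>s. indicator {0<..<t} s * (frac_series \<alpha> c A (t - s) * frac_series \<alpha> d B s))
    (frac_series \<alpha> (c + d) (A * B) t)"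
proof -
  define a where "a = (\<lambda>n s. fps_nth A n * rl_kernel (\<alpha> * real n + c) s)"
  define b where "b = (\<lambda>n s. fps_nth B n * rl_kernel (\<alpha> * real n + d) s)"
  define u where "u = (\<lambda>n s. \<Sum>i\<le>n. indicator {0<..<t} s * (a i (t - s) * b (n - i) s))"
  define A' where "A' = Abs_fps (\<lambda>n. \<bar>fps_nth A n\<bar>)"
  define B' where "B' = Abs_fps (\<lambda>n. \<bar>fps_nth B n\<bar>)"
  have A': "fps_conv_radius A' > 0" and B': "fps_conv_radius B' > 0"
    using A B fps_conv_radius_norm[of A] fps_conv_radius_norm[of B]
    by (auto simp: A'_def B'_def)
  \<comment> \<open>Stated for coefficients that may differ from those of \<open>A\<close> and \<open>B\<close>, so that it serves
    for the series of absolute values too.\<close>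
  have ker: "has_bochner_integral lborel (\<lambda>s. indicator {0<..<t} s *
      ((x * rl_kernel (\<alpha> * real i + c) (t - s)) * (y * rl_kernel (\<alpha> * real j + d) s)))
      (x * y * rl_kernel (\<alpha> * real (i + j) + (c + d)) t)"
    if "x = 0 \<or> fps_nth A i \<noteq> 0" "y = 0 \<or> fps_nth B j \<noteq> 0" for i j x y
  proof (cases "x = 0 \<or> y = 0")
    case True
    thus ?thesis by auto
  next
    case False
    have "\<alpha> * real i + c > 0"
    proof (cases "i = 0")
      case True
      thus ?thesis using that False c by auto
    qed (use \<alpha> cd in \<open>auto intro: add_pos_nonneg\<close>)
    moreover have "\<alpha> * real j + d > 0"
    proof (cases "j = 0")
      case True
      thus ?thesis using that False d by auto
    qed (use \<alpha> cd in \<open>auto intro: add_pos_nonneg\<close>)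
    ultimately have "has_bochner_integral lborel (\<lambda>s. x * y * (indicator {0<..<t} s *
       (rl_kernel (\<alpha> * real i + c) (t - s) * rl_kernel (\<alpha> * real j + d) s)))
       (x * y * rl_kernel ((\<alpha> * real i + c) + (\<alpha> * real j + d)) t)"
      by (intro has_bochner_integral_mult_right rl_kernel_convolution t)
    thus ?thesis by (simp add: algebra_simps)
  qed
  have int_u: "has_bochner_integral lborel (u n)
      (fps_nth (A * B) n * rl_kernel (\<alpha> * real n + (c + d)) t)" for n
  proof -
    have "has_bochner_integral lborel (u n) (\<Sum>i\<le>n. fps_nth A i * fps_nth B (n - i) *
          rl_kernel (\<alpha> * real (i + (n - i)) + (c + d)) t)"
      unfolding u_def a_def b_def by (intro has_bochner_integral_sum ker) auto
    also have "(\<Sum>i\<le>n. fps_nth A i * fps_nth B (n - i) *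
          rl_kernel (\<alpha> * real (i + (n - i)) + (c + d)) t) = fps_nth (A * B) n * rl_kernel (\<alpha> * real n + (c + d)) t"
      unfolding fps_mult_nth sum_distrib_right by (intro sum.cong) (auto simp: atMost_atLeast0)
    finally show ?thesis .
  qed
  define v where "v = (\<lambda>n s. \<Sum>i\<le>n. indicator {0<..<t} s * (\<bar>a i (t - s)\<bar> * \<bar>b (n - i) s\<bar>))"
  have abs_a: "\<bar>a n s\<bar> = fps_nth A' n * rl_kernel (\<alpha> * real n + c) s" for n s
  proof (cases "\<alpha> * real n + c > 0")
    case False
    hence "\<alpha> * real n + c = 0" using \<alpha> cd by (smt (verit) mult_nonneg_nonneg of_nat_0_le_iff)
    thus ?thesis by (simp add: a_def A'_def)
  qed (simp add: a_def A'_def abs_mult rl_kernel_nonneg)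
  have abs_b: "\<bar>b n s\<bar> = fps_nth B' n * rl_kernel (\<alpha> * real n + d) s" for n s
  proof (cases "\<alpha> * real n + d > 0")
    case False
    hence "\<alpha> * real n + d = 0" using \<alpha> cd by (smt (verit) mult_nonneg_nonneg of_nat_0_le_iff)
    thus ?thesis by (simp add: b_def B'_def)
  qed (simp add: b_def B'_def abs_mult rl_kernel_nonneg)
  have int_v: "has_bochner_integral lborel (v n)
      (fps_nth (A' * B') n * rl_kernel (\<alpha> * real n + (c + d)) t)" for n
  proof -
    have "has_bochner_integral lborel (v n) (\<Sum>i\<le>n. fps_nth A' i * fps_nth B' (n - i) *
          rl_kernel (\<alpha> * real (i + (n - i)) + (c + d)) t)"
      unfolding v_def abs_a abs_b by (intro has_bochner_integral_sum ker) (auto simp: A'_def B'_def)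
    also have "(\<Sum>i\<le>n. fps_nth A' i * fps_nth B' (n - i) *
          rl_kernel (\<alpha> * real (i + (n - i)) + (c + d)) t) = fps_nth (A' * B') n * rl_kernel (\<alpha> * real n + (c + d)) t"
      unfolding fps_mult_nth sum_distrib_right by (intro sum.cong) (auto simp: atMost_atLeast0)
    finally show ?thesis .
  qed
  have uv: "norm (u n s) \<le> v n s" for n s
    unfolding u_def v_def by (rule order.trans[OF norm_sum]) (simp add: abs_mult)
  have prod: "(\<lambda>n. u n s) sums (indicator {0<..<t} s * (frac_series \<alpha> c A (t - s) * frac_series \<alpha> d B s))"
    and summ: "summable (\<lambda>n. norm (u n s))" for s
  proof -
    consider "s \<notin> {0<..<t}" | "s \<in> {0<..<t}" by blast
    hence "(\<lambda>n. u n s) sums (indicator {0<..<t} s * (frac_series \<alpha> c A (t - s) * frac_series \<alpha> d B s))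
      \<and> summable (\<lambda>n. norm (u n s))"
    proof cases
      case 2
      have a: "summable (\<lambda>n. norm (a n (t - s)))" and b: "summable (\<lambda>n. norm (b n s))"
        using 2 unfolding a_def b_def by (intro frac_series_summable_norm A B \<alpha>; simp)+
      have "summable (\<lambda>n. \<Sum>i\<le>n. norm (a i (t - s)) * norm (b (n - i) s))"
        by (rule sums_summable, rule Cauchy_product_sums) (use a b in auto)
      moreover have "v n s = (\<Sum>i\<le>n. norm (a i (t - s)) * norm (b (n - i) s))" for n
        using 2 unfolding v_def by simp
      ultimately have v: "summable (\<lambda>n. v n s)" by simp
      have "summable (\<lambda>n. norm (u n s))"
        by (rule summable_comparison_test'[OF v, of 0]) (use uv in auto)
      moreover have "(\<lambda>n. u n s) sums ((\<Sum>n. a n (t - s)) * (\<Sum>n. b n s))"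
        using Cauchy_product_sums[OF a b] 2 unfolding u_def by simp
      ultimately show ?thesis using 2 by (simp add: a_def b_def frac_series_def)
    next
      case 1
      hence "u n s = 0" for n unfolding u_def by simp
      thus ?thesis using 1 by simp
    qed
    thus "(\<lambda>n. u n s) sums (indicator {0<..<t} s * (frac_series \<alpha> c A (t - s) * frac_series \<alpha> d B s))"
      and "summable (\<lambda>n. norm (u n s))" by auto
  qed
  have int: "integrable lborel (u n)" for n
    using int_u by (simp add: has_bochner_integral_iff)
  have sL: "summable (\<lambda>n. \<integral>s. norm (u n s) \<partial>lborel)"
  proof (rule summable_comparison_test'[where N = 0])
    show "summable (\<lambda>n. norm (fps_nth (A' * B') n * rl_kernel (\<alpha> * real n + (c + d)) t))"
      by (intro frac_series_summable_norm fps_conv_radius_pos A' B' \<alpha> t)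
    fix n
    have "(\<integral>s. norm (u n s) \<partial>lborel) \<le> (\<integral>s. v n s \<partial>lborel)"
      using int[of n] int_v[of n] uv by (intro integral_mono) (auto simp: has_bochner_integral_iff)
    also have "\<dots> = fps_nth (A' * B') n * rl_kernel (\<alpha> * real n + (c + d)) t"
      using int_v by (simp add: has_bochner_integral_iff)
    finally show "norm (\<integral>s. norm (u n s) \<partial>lborel) \<le>
      norm (fps_nth (A' * B') n * rl_kernel (\<alpha> * real n + (c + d)) t)" by (simp add: norm_mult)
  qed
  have "(\<lambda>n. integral\<^sup>L lborel (u n)) sums (\<integral>s. (\<Sum>n. u n s) \<partial>lborel)"
    by (rule sums_integral[OF int _ sL]) (use summ in auto)
  moreover have "integrable lborel (\<lambda>s. \<Sum>n. u n s)"
    by (rule integrable_suminf[OF int _ sL]) (use summ in auto)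
  moreover have "(\<lambda>s. \<Sum>n. u n s) = 
      (\<lambda>s. indicator {0<..<t} s * (frac_series \<alpha> c A (t - s) * frac_series \<alpha> d B s))"
    using prod by (auto simp: sums_iff)
  moreover have "(\<lambda>n. integral\<^sup>L lborel (u n)) sums frac_series \<alpha> (c + d) (A * B) t"
    using frac_series_sums[OF _ \<alpha> t, of "A * B" "c + d"] int_u A B
    by (simp add: has_bochner_integral_iff fps_conv_radius_pos)
  ultimately show ?thesis by (auto simp: has_bochner_integral_iff sums_iff)
qed

text \<open>
  The series is \<open>t\<^bsup>c-1\<^esup> P(t\<^sup>\<alpha>)\<close> with an entire function \<open>P\<close>, so it may be differentiated termwise; the
  functional equation of \<^const>\<open>rGamma\<close> absorbs the exponents.
\<close>
lemma frac_series_has_derivative: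
  assumes A: "fps_conv_radius A > 0" and \<alpha>: "\<alpha> > 0" and t: "t > 0"
  shows "(frac_series \<alpha> c A has_field_derivative frac_series \<alpha> (c - 1) A t) (at t)"
proof -
  define p where "p = (\<lambda>n. fps_nth A n * rGamma (\<alpha> * real n + c))"
  define P where "P = (\<lambda>y. \<Sum>n. p n * y ^ n)"
  have sp: "summable (\<lambda>n. p n * y ^ n)" for y
    unfolding p_def by (intro summable_norm_cancel[OF summable_rGamma_powser] A \<alpha>)
  have eq: "frac_series \<alpha> c A s = s powr (c - 1) * P (s powr \<alpha>)" if "s > 0" for s
    unfolding frac_series_def P_def using that sp[of "s powr \<alpha>"]
    by (simp add: rl_kernel_power suminf_mult[symmetric] p_def mult_ac)
  have dP: "(P has_field_derivative (\<Sum>n. diffs p n * y ^ n)) (at y)" for y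
    unfolding P_def by (rule termdiffs_strong_converges_everywhere) (rule sp)
  define y where "y = t powr \<alpha>"
  have dy: "y > 0" using t by (simp add: y_def)
  have "((\<lambda>s. s powr (c - 1) * P (s powr \<alpha>)) has_field_derivative
      ((c - 1) * t powr (c - 2) * P y + t powr (c - 1) * ((\<Sum>n. diffs p n * y ^ n) * (\<alpha> * t powr (\<alpha> - 1))))) (at t)"
    unfolding y_def using t
    by (auto intro!: derivative_eq_intros DERIV_chain2[OF dP] simp: algebra_simps)
  hence "(frac_series \<alpha> c A has_field_derivative
      ((c - 1) * t powr (c - 2) * P y + t powr (c - 1) * ((\<Sum>n. diffs p n * y ^ n) * (\<alpha> * t powr (\<alpha> - 1))))) (at t)"
    by (rule has_field_derivative_transform_within_open[where S = "{0<..}"]) (use eq t in auto)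
  moreover have "frac_series \<alpha> (c - 1) A t =
      (c - 1) * t powr (c - 2) * P y + t powr (c - 1) * ((\<Sum>n. diffs p n * y ^ n) * (\<alpha> * t powr (\<alpha> - 1)))"
  proof -
    have "summable (\<lambda>n. diffs p n * y ^ n)"
      by (rule termdiff_converges_all) (rule sp)
    hence "(\<lambda>n. real n * p n * y ^ (n - Suc 0)) sums (\<Sum>n. diffs p n * y ^ n)"
      by (rule diffs_equiv)
    from sums_mult[OF this, of "\<alpha> * y"]
    have 1: "(\<lambda>n. \<alpha> * real n * p n * y ^ n) sums (\<alpha> * y * (\<Sum>n. diffs p n * y ^ n))"
    proof (rule sums_cong[THEN iffD1, rotated])
      show "\<alpha> * y * (real n * p n * y ^ (n - Suc 0)) = \<alpha> * real n * p n * y ^ n" for n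
        by (cases n) auto
    qed
    have 2: "(\<lambda>n. (c - 1) * (p n * y ^ n)) sums ((c - 1) * P y)"
      unfolding P_def by (intro sums_mult summable_sums sp)
    from sums_mult[OF sums_add[OF 1 2], of "t powr (c - 2)"]
    have "(\<lambda>n. t powr (c - 2) * (\<alpha> * real n * p n * y ^ n + (c - 1) * (p n * y ^ n))) sums
       (t powr (c - 2) * (\<alpha> * y * (\<Sum>n. diffs p n * y ^ n) + (c - 1) * P y))" .
    moreover have "t powr (c - 2) * (\<alpha> * real n * p n * y ^ n + (c - 1) * (p n * y ^ n)) =
       fps_nth A n * rl_kernel (\<alpha> * real n + (c - 1)) t" for n
    proof -
      have "rGamma (\<alpha> * real n + (c - 1)) = (\<alpha> * real n + c - 1) * rGamma (\<alpha> * real n + c)"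
        using rGamma_plus1[of "\<alpha> * real n + (c - 1)"] by (simp add: add_diff_eq)
      moreover have "c - 1 - 1 = c - 2" by simp
      ultimately have "rl_kernel (\<alpha> * real n + (c - 1)) t =
          t powr (c - 2) * ((\<alpha> * real n + c - 1) * rGamma (\<alpha> * real n + c) * y ^ n)"
        unfolding rl_kernel_power[OF t, of \<alpha> n "c - 1"] y_def by simp
      thus ?thesis unfolding p_def by (simp only:) (simp add: algebra_simps)
    qed
    ultimately have "frac_series \<alpha> (c - 1) A t = t powr (c - 2) * (\<alpha> * y * (\<Sum>n. diffs p n * y ^ n) + (c - 1) * P y)"
      unfolding frac_series_def by (simp add: sums_iff)
    also have "\<dots> = (c - 1) * t powr (c - 2) * P y + (t powr (c - 2) * y) * \<alpha> * (\<Sum>n. diffs p n * y ^ n)"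
      by (simp add: algebra_simps)
    also have "t powr (c - 2) * y = t powr (c - 1) * t powr (\<alpha> - 1)"
      unfolding y_def powr_add[symmetric] by (simp add: algebra_simps)
    finally show ?thesis by (simp add: mult_ac)
  qed
  ultimately show ?thesis by simp
qed

lemma frac_series_continuous_on:
  assumes "fps_conv_radius A > 0" "\<alpha> > 0"
  shows "continuous_on {0<..} (frac_series \<alpha> c A)"
  by (rule DERIV_continuous_on, rule has_field_derivative_at_within,
      rule frac_series_has_derivative) (use assms in auto)

text \<open>
  Integration from 0 is convolution with the constant kernel \<open>k\<^sub>1\<close>.
\<close>
lemma frac_series_integral:
  assumes "fps_conv_radius A > 0" "\<alpha> > 0" "t > 0" "fps_nth A 0 = 0"
  shows "has_bochner_integral lborel (\<lambda>s. indicator {0<..<t} s * frac_series \<alpha> 0 A s)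
     (frac_series \<alpha> 1 A t)"
proof -
  have "has_bochner_integral lborel
    (\<lambda>s. indicator {0<..<t} s * (frac_series \<alpha> 1 1 (t - s) * frac_series \<alpha> 0 A s))
    (frac_series \<alpha> (1 + 0) (1 * A) t)"
    using assms by (intro frac_series_convolution) auto
  moreover have "indicator {0<..<t} s * (frac_series \<alpha> 1 1 (t - s) * frac_series \<alpha> 0 A s) =
     indicator {0<..<t} s * frac_series \<alpha> 0 A s" for s
    by (cases "s \<in> {0<..<t}") (auto simp: rl_kernel_1)
  ultimately show ?thesis by (simp only: add_0_right mult_1_left)
qed

section \<open>Caputo derivatives as shifts of coefficients\<close>

text \<open>
  The integral in the definition of the Caputo derivative is a convolution with a kernel, hence
  raises the index.
\<close>
lemma abel_integral_frac_series:
  assumes A: "fps_conv_radius A > 0" and pos: "\<alpha> > 0" "t > 0" "c > 0" "d \<ge> 0"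
    and d: "d > 0 \<or> fps_nth A 0 = 0"
    and h: "\<And>s. 0 < s \<Longrightarrow> s < t \<Longrightarrow> h s = frac_series \<alpha> d A s"
  shows "set_integrable lborel {0<..<t} (\<lambda>s. (t - s) powr (c - 1) * h s)"
    and "1 / Gamma c * (LBINT s:{0<..<t}. (t - s) powr (c - 1) * h s) = frac_series \<alpha> (c + d) A t"
proof -
  have G: "Gamma c > 0" using pos by (simp add: Gamma_real_pos)
  have "has_bochner_integral lborel
    (\<lambda>s. indicator {0<..<t} s * (frac_series \<alpha> c 1 (t - s) * frac_series \<alpha> d A s))
    (frac_series \<alpha> (c + d) (1 * A) t)"
    using assms by (intro frac_series_convolution) auto
  from has_bochner_integral_mult_right[OF this, of "Gamma c"]
  have "has_bochner_integral lborel
    (\<lambda>s. Gamma c * (indicator {0<..<t} s * (frac_series \<alpha> c 1 (t - s) * frac_series \<alpha> d A s)))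
    (Gamma c * frac_series \<alpha> (c + d) A t)" by simp
  moreover have "Gamma c * (indicator {0<..<t} s * (frac_series \<alpha> c 1 (t - s) * frac_series \<alpha> d A s)) =
      indicator {0<..<t} s *\<^sub>R ((t - s) powr (c - 1) * h s)" for s
    using G by (cases "s \<in> {0<..<t}") (auto simp: h rl_kernel_def rGamma_inverse_Gamma)
  ultimately have "has_bochner_integral lborel
    (\<lambda>s. indicator {0<..<t} s *\<^sub>R ((t - s) powr (c - 1) * h s))
    (Gamma c * frac_series \<alpha> (c + d) A t)" by (simp only: mult_1_left)
  thus "set_integrable lborel {0<..<t} (\<lambda>s. (t - s) powr (c - 1) * h s)"
    and "1 / Gamma c * (LBINT s:{0<..<t}. (t - s) powr (c - 1) * h s) = frac_series \<alpha> (c + d) A t"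
    using G by (auto simp: set_integrable_def set_lebesgue_integral_def has_bochner_integral_iff)
qed

lemma deriv_frac_series:
  assumes A: "fps_conv_radius A > 0" and \<alpha>: "\<alpha> > 0"
    and f: "\<And>s. s > 0 \<Longrightarrow> f s = frac_series \<alpha> c A s" and s: "s > 0"
  shows "f field_differentiable at s" "deriv f s = frac_series \<alpha> (c - 1) A s"
proof -
  have "(f has_field_derivative frac_series \<alpha> (c - 1) A s) (at s)"
    by (rule has_field_derivative_transform_within_open[OF frac_series_has_derivative[OF A \<alpha> s], where S = "{0<..}"])
       (use f s in auto)
  thus "f field_differentiable at s" "deriv f s = frac_series \<alpha> (c - 1) A s"
    by (auto simp: field_differentiable_def DERIV_imp_deriv)
qed

lemma frac_series_0_shift:
  assumes "fps_conv_radius A > 0" "\<alpha> > 0" "t > 0"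
  shows "frac_series \<alpha> 0 A t = frac_series \<alpha> \<alpha> (fps_shift 1 A) t"
  using frac_series_shift[OF assms, of 0] by simp

lemma frac_series_shift_2:
  assumes "fps_conv_radius A > 0" "\<alpha> > 0" "t > 0" "fps_nth A 0 * rl_kernel c t = 0" "fps_nth A 1 = 0"
  shows "frac_series \<alpha> c A t = frac_series \<alpha> (c + 2 * \<alpha>) (fps_shift 2 A) t"
proof -
  have "frac_series \<alpha> c A t = frac_series \<alpha> (c + \<alpha>) (fps_shift 1 A) t"
    using assms by (intro frac_series_shift) auto
  also have "\<dots> = frac_series \<alpha> (c + \<alpha> + \<alpha>) (fps_shift 1 (fps_shift 1 A)) t"
    using assms by (intro frac_series_shift) auto
  also have "fps_shift 1 (fps_shift 1 A) = fps_shift 2 A" by (rule fps_ext) (simp add: numeral_2_eq_2)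
  finally show ?thesis by (simp add: algebra_simps)
qed

text \<open>
  Differentiation leads from index 1 to index 0 and kills the constant term, the integral of order
  \<open>1 - \<alpha>\<close> leads to index \<open>1 - \<alpha>\<close>, and dividing the series by \<open>x\<close> brings the index back to 1.
\<close>
lemma caputo_frac_series:
  assumes A: "fps_conv_radius A > 0" and \<alpha>: "0 < \<alpha>" "\<alpha> \<le> 1"
    and f: "\<And>s. s > 0 \<Longrightarrow> f s = frac_series \<alpha> 1 A s" and t: "t > 0"
  shows "caputo_differentiable \<alpha> f t" "caputo_deriv \<alpha> f t = frac_series \<alpha> 1 (fps_shift 1 A) t"
proof -
  have d: "f field_differentiable at s" "deriv f s = frac_series \<alpha> \<alpha> (fps_shift 1 A) s" if "s > 0" for s
    using deriv_frac_series[OF A \<alpha>(1) f that] frac_series_0_shift[OF A \<alpha>(1) that] by auto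
  have A1: "fps_conv_radius (fps_shift 1 A) > 0" using A by simp
  consider "\<alpha> = 1" | "\<alpha> < 1" using \<alpha> by force
  hence "caputo_differentiable \<alpha> f t \<and> caputo_deriv \<alpha> f t = frac_series \<alpha> 1 (fps_shift 1 A) t"
  proof cases
    case 1
    thus ?thesis using d t by (simp add: caputo_differentiable_def caputo_deriv_def)
  next
    case 2
    note * = abel_integral_frac_series[OF A1 \<alpha>(1) t, of "1 - \<alpha>" \<alpha> "deriv f"]
    from 2 show ?thesis using d t \<alpha> * by (simp add: caputo_differentiable_def caputo_deriv_def)
  qed
  thus "caputo_differentiable \<alpha> f t" "caputo_deriv \<alpha> f t = frac_series \<alpha> 1 (fps_shift 1 A) t" by auto
qed

lemma rl_kernel_minus_1 [simp]: "rl_kernel (- 1) t = 0"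
  using rGamma_plus1[of "-1 :: real"] by (simp add: rl_kernel_def)

text \<open>
  The argument is the same as for the order \<open>\<alpha>\<close>, once for each branch of the definition. The
  coefficient of \<open>x\<close> belongs to \<open>t\<^sup>\<alpha>\<close>. Were it not zero, the derivative of order \<open>2\<alpha>\<close> would contain
  the singular power \<open>t\<^bsup>-\<alpha>\<^esup>\<close> when \<open>2\<alpha> < 1\<close>, and for \<open>1 < 2\<alpha> < 2\<close> the second derivative would not be
  integrable at 0.
\<close>
lemma caputo_2_frac_series:
  assumes A: "fps_conv_radius A > 0" and \<alpha>: "0 < \<alpha>" "\<alpha> \<le> 1" and A_1: "fps_nth A 1 = 0"
    and f: "\<And>s. s > 0 \<Longrightarrow> f s = frac_series \<alpha> 1 A s" and t: "t > 0"
  shows "caputo_differentiable (2 * \<alpha>) f t"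
    "caputo_deriv (2 * \<alpha>) f t = frac_series \<alpha> 1 (fps_shift 2 A) t"
proof -
  have A2: "fps_conv_radius (fps_shift 2 A) > 0" using A by simp
  have d0: "f field_differentiable at s" "deriv f s = frac_series \<alpha> 0 A s" if "s > 0" for s
    using deriv_frac_series[OF A \<alpha>(1) f that] by auto
  have d: "deriv f s = frac_series \<alpha> (2 * \<alpha>) (fps_shift 2 A) s" if "s > 0" for s
    using d0[OF that] frac_series_shift_2[OF A \<alpha>(1) that, of 0] A_1 by simp
  have dd: "deriv f field_differentiable at s"
    "deriv (deriv f) s = frac_series \<alpha> (2 * \<alpha> - 1) (fps_shift 2 A) s" if "s > 0" for s
    using deriv_frac_series[OF A \<alpha>(1) d0(2) that] frac_series_shift_2[OF A \<alpha>(1) that, of "-1"] A_1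
    by auto
  consider "2 * \<alpha> < 1" | "2 * \<alpha> = 1" | "1 < 2 * \<alpha>" "2 * \<alpha> < 2" | "2 * \<alpha> = 2" using \<alpha> by force
  hence "caputo_differentiable (2 * \<alpha>) f t \<and> caputo_deriv (2 * \<alpha>) f t = frac_series \<alpha> 1 (fps_shift 2 A) t"
  proof cases
    case 1
    have "set_integrable lborel {0<..<t} (\<lambda>s. (t - s) powr ((1 - 2 * \<alpha>) - 1) * deriv f s)"
      "1 / Gamma (1 - 2 * \<alpha>) * (LBINT s:{0<..<t}. (t - s) powr ((1 - 2 * \<alpha>) - 1) * deriv f s) =
       frac_series \<alpha> ((1 - 2 * \<alpha>) + 2 * \<alpha>) (fps_shift 2 A) t"
      using abel_integral_frac_series[OF A2 \<alpha>(1) t, of "1 - 2 * \<alpha>" "2 * \<alpha>" "deriv f"] 1 d \<alpha> by auto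
    thus ?thesis using 1 d0 t by (simp add: caputo_differentiable_def caputo_deriv_def)
  next
    case 2
    thus ?thesis using d0[OF t] d[OF t] unfolding 2 by (simp add: caputo_differentiable_def caputo_deriv_def)
  next
    case 3
    have "set_integrable lborel {0<..<t} (\<lambda>s. (t - s) powr ((2 - 2 * \<alpha>) - 1) * deriv (deriv f) s)"
      "1 / Gamma (2 - 2 * \<alpha>) * (LBINT s:{0<..<t}. (t - s) powr ((2 - 2 * \<alpha>) - 1) * deriv (deriv f) s) =
       frac_series \<alpha> ((2 - 2 * \<alpha>) + (2 * \<alpha> - 1)) (fps_shift 2 A) t"
      using abel_integral_frac_series[OF A2 \<alpha>(1) t, of "2 - 2 * \<alpha>" "2 * \<alpha> - 1" "deriv (deriv f)"] 3 dd \<alpha> by auto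
    moreover have "2 - 2 * \<alpha> - 1 = 1 - 2 * \<alpha>" by simp
    ultimately show ?thesis using 3 d0 dd t by (simp add: caputo_differentiable_def caputo_deriv_def)
  next
    case 4
    have "\<forall>\<^sub>F s in nhds t. s > 0" using t by (intro eventually_nhds_in_open[of "{0<..}", simplified]) auto
    hence "\<forall>\<^sub>F s in nhds t. f field_differentiable at s" by eventually_elim (rule d0)
    thus ?thesis using dd[OF t] unfolding 4 by (simp add: caputo_differentiable_def caputo_deriv_def)
  qed
  thus "caputo_differentiable (2 * \<alpha>) f t"
    "caputo_deriv (2 * \<alpha>) f t = frac_series \<alpha> 1 (fps_shift 2 A) t" by auto
qed

section \<open>Positivity of the relaxation density\<close>

text \<open>
  The series \<open>\<lambda>x / (1 + \<lambda>x)\<close>. At index 0 it represents \<open>\<lambda> t\<^bsup>\<alpha>-1\<^esup> E\<^bsub>\<alpha>,\<alpha>\<^esub>(-\<lambda> t\<^sup>\<alpha>)\<close>, the waiting time density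
  of the fractional Poisson process.
\<close>
definition relax_fps :: "real \<Rightarrow> real fps" where
  "relax_fps lam = fps_const lam * fps_X * inverse (1 + fps_const lam * fps_X)"

lemma relax_fps_nth_0 [simp]: "fps_nth (relax_fps lam) 0 = 0"
  by (simp add: relax_fps_def)

lemma relax_fps_conv_radius: "fps_conv_radius (relax_fps lam) > 0"
  unfolding relax_fps_def
  by (intro fps_conv_radius_pos fps_conv_radius_inverse_pos) auto

lemma relax_fps_eq: "(1 + fps_const lam * fps_X) * relax_fps lam = fps_const lam * fps_X"
proof -
  have "(1 + fps_const lam * fps_X) * inverse (1 + fps_const lam * fps_X) = 1"
    by (rule inverse_mult_eq_1') simp
  thus ?thesis unfolding relax_fps_def by (metis mult.left_commute mult.right_neutral)
qed

text \<open>
  The logarithm of a kernel of index at most 1 is convex, so \<open>k(u - s) / k(t - s)\<close> does not exceed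
  \<open>k(u) / k(t)\<close>.
\<close>
lemma rl_kernel_log_convex:
  assumes "0 < \<alpha>" "\<alpha> \<le> 1" "0 < s" "s < t" "t \<le> u"
  shows "rl_kernel \<alpha> (u - s) * rl_kernel \<alpha> t \<le> rl_kernel \<alpha> u * rl_kernel \<alpha> (t - s)"
proof -
  have "((u - s) * t) powr (\<alpha> - 1) \<le> (u * (t - s)) powr (\<alpha> - 1)"
  proof (rule powr_mono2')
    show "u * (t - s) \<le> (u - s) * t" using assms by (simp add: algebra_simps)
  qed (use assms in auto)
  hence "((u - s) powr (\<alpha> - 1) * t powr (\<alpha> - 1)) * (rGamma \<alpha> * rGamma \<alpha>) \<le>
         (u powr (\<alpha> - 1) * (t - s) powr (\<alpha> - 1)) * (rGamma \<alpha> * rGamma \<alpha>)"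
    using assms by (intro mult_right_mono) (auto simp: powr_mult)
  thus ?thesis by (simp add: rl_kernel_def mult_ac)
qed

text \<open>
  The Volterra equation \<open>g = \<lambda>k - \<lambda>(k * g)\<close>, read off from \<open>(1 + \<lambda>x) g = \<lambda>x\<close>.
\<close>
lemma relax_eq:
  fixes lam :: real
  assumes "0 < \<alpha>" "t > 0"
  defines "g \<equiv> frac_series \<alpha> 0 (relax_fps lam)"
  shows "has_bochner_integral lborel (\<lambda>s. indicator {0<..<t} s * (rl_kernel \<alpha> (t - s) * g s))
    (frac_series \<alpha> 0 (fps_X * relax_fps lam) t)"
    and "g t = lam * rl_kernel \<alpha> t - lam * frac_series \<alpha> 0 (fps_X * relax_fps lam) t"
proof -
  have "has_bochner_integral lborel (\<lambda>s. indicator {0<..<t} s *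
      (frac_series \<alpha> 0 fps_X (t - s) * frac_series \<alpha> 0 (relax_fps lam) s))
    (frac_series \<alpha> (0 + 0) (fps_X * relax_fps lam) t)"
    using assms by (intro frac_series_convolution relax_fps_conv_radius) auto
  thus "has_bochner_integral lborel (\<lambda>s. indicator {0<..<t} s * (rl_kernel \<alpha> (t - s) * g s))
    (frac_series \<alpha> 0 (fps_X * relax_fps lam) t)"
    by (simp add: g_def)
  have "relax_fps lam = fps_const lam * fps_X - fps_const lam * (fps_X * relax_fps lam)"
    using relax_fps_eq[of lam] by (simp add: algebra_simps)
  hence "g t = frac_series \<alpha> 0 (fps_const lam * fps_X - fps_const lam * (fps_X * relax_fps lam)) t"
    by (simp add: g_def)
  also have "\<dots> = lam * rl_kernel \<alpha> t - lam * frac_series \<alpha> 0 (fps_X * relax_fps lam) t"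
    using assms relax_fps_conv_radius[of lam]
    by (simp add: frac_series_diff frac_series_cmult fps_conv_radius_pos)
  finally show "g t = lam * rl_kernel \<alpha> t - lam * frac_series \<alpha> 0 (fps_X * relax_fps lam) t" .
qed

text \<open>
  Near 0 the leading term \<open>\<lambda> t\<^bsup>\<alpha>-1\<^esup> / \<Gamma>(\<alpha>)\<close> dominates.
\<close>
lemma relax_pos_near_0:
  assumes "0 < \<alpha>" "lam > 0"
  obtains e where "e > 0" "\<And>t. 0 < t \<Longrightarrow> t < e \<Longrightarrow> frac_series \<alpha> 0 (relax_fps lam) t > 0"
proof -
  define B where "B = fps_shift 1 (relax_fps lam)"
  have B0: "fps_nth B 0 = lam" by (simp add: B_def relax_fps_def)
  have BR: "fps_conv_radius B > 0" using relax_fps_conv_radius[of lam] by (simp add: B_def)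
  define P where "P = (\<lambda>y. \<Sum>n. fps_nth B n * rGamma (\<alpha> * real n + \<alpha>) * y ^ n)"
  have sp: "summable (\<lambda>n. fps_nth B n * rGamma (\<alpha> * real n + \<alpha>) * y ^ n)" for y
    by (intro summable_norm_cancel[OF summable_rGamma_powser] BR assms)
  have eq: "frac_series \<alpha> 0 (relax_fps lam) t = t powr (\<alpha> - 1) * P (t powr \<alpha>)" if "t > 0" for t
  proof -
    have "frac_series \<alpha> 0 (relax_fps lam) t = frac_series \<alpha> (0 + \<alpha>) B t"
      unfolding B_def using that assms relax_fps_conv_radius by (intro frac_series_shift) auto
    also have "\<dots> = t powr (\<alpha> - 1) * P (t powr \<alpha>)"
      unfolding frac_series_def P_def using that sp[of "t powr \<alpha>"]
      by (simp add: rl_kernel_power suminf_mult[symmetric] mult_ac)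
    finally show ?thesis .
  qed
  have "isCont P 0"
    unfolding P_def by (rule isCont_powser_converges_everywhere) (rule sp)
  moreover have "P 0 = lam * rGamma \<alpha>"
    unfolding P_def by (subst powser_zero) (simp add: B0)
  moreover have "lam * rGamma \<alpha> > 0"
    using assms by (simp add: rGamma_inverse_Gamma Gamma_real_pos)
  ultimately have "eventually (\<lambda>y. P y > 0) (at 0)"
    by (intro order_tendstoD(1)[where y = "P 0"]) (auto simp: isCont_def)
  then obtain d where d: "d > 0" "\<And>y. y \<noteq> 0 \<Longrightarrow> dist y 0 < d \<Longrightarrow> P y > 0"
    unfolding eventually_at by auto
  show ?thesis
  proof (rule that)
    show "d powr (1 / \<alpha>) > 0" using d by simp
    fix t assume t: "0 < t" "t < d powr (1 / \<alpha>)"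
    have "t powr \<alpha> < (d powr (1 / \<alpha>)) powr \<alpha>" using t assms by (intro powr_less_mono2) auto
    hence "t powr \<alpha> < d" using assms d by (simp add: powr_powr)
    thus "frac_series \<alpha> 0 (relax_fps lam) t > 0" using t by (simp add: eq d)
  qed
qed

text \<open>
  Suppose that \<open>g\<close> has a first zero \<open>u\<close>. For \<open>r < u\<close> close to \<open>u\<close>, compare the convolutions \<open>K = k * g\<close> at
  \<open>r\<close> and \<open>u\<close>. By log-convexity, the part of the integral for \<open>K(u)\<close> over \<open>(0, r)\<close> is at most
  \<open>k(u) / k(r) K(r)\<close>, which by the Volterra equation is \<open>k(u) - k(u) g(r) / (\<lambda> k(r))\<close>.
  If \<open>r\<close> is chosen as a maximum point of \<open>g\<close> on a short interval \<open>[u - \<delta>, u]\<close>, the remaining part is at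
  most \<open>g(r)\<close> times the small integral of \<open>k\<close> over \<open>(0, \<delta>)\<close>. Hence \<open>K(u) < k(u)\<close>, which means
  \<open>g(u) > 0\<close>.
\<close>
lemma relax_pos:
  assumes "0 < \<alpha>" "\<alpha> \<le> 1" "lam > 0" "t > 0"
  shows "frac_series \<alpha> 0 (relax_fps lam) t > 0"
proof (rule ccontr)
  define g where "g = frac_series \<alpha> 0 (relax_fps lam)"
  define k where "k = rl_kernel \<alpha>"
  assume "\<not> ?thesis"
  hence t: "g t \<le> 0" by (simp add: g_def)
  obtain e where e: "e > 0" "\<And>t. 0 < t \<Longrightarrow> t < e \<Longrightarrow> g t > 0"
    using relax_pos_near_0[OF assms(1,3)] unfolding g_def by metis
  have cont: "continuous_on {0<..} g"
    unfolding g_def by (intro frac_series_continuous_on relax_fps_conv_radius assms)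
  have e_le: "e \<le> t" using e(2)[of t] t assms by force
  \<comment> \<open>Starting the search for a zero at \<open>e/2\<close> makes the set of candidates compact.\<close>
  define Z where "Z = {s \<in> {e/2..t}. g s \<le> 0}"
  have "closed ({e/2..t} \<inter> g -` {..0})"
    by (intro continuous_closed_preimage continuous_on_subset[OF cont]) (use e in auto)
  moreover have "Z = {e/2..t} \<inter> g -` {..0}" by (auto simp: Z_def)
  ultimately have "closed Z" by simp
  moreover have "bounded Z" by (rule bounded_subset[of "{e/2..t}"]) (auto simp: Z_def)
  ultimately have "compact Z" by (simp add: compact_eq_bounded_closed)
  moreover have "t \<in> Z" using t e e_le by (auto simp: Z_def)
  ultimately obtain u where u: "u \<in> Z" "\<And>s. s \<in> Z \<Longrightarrow> u \<le> s"
    using compact_attains_inf[of Z] by blast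
  have u0: "u > 0" using u e by (auto simp: Z_def)
  have pos: "g s > 0" if "0 < s" "s < u" for s
  proof (cases "s < e")
    case False
    hence "s \<notin> Z" using u(2)[of s] that by auto
    thus ?thesis using False that u e by (auto simp: Z_def)
  qed (use e that in auto)
  have gu: "g u \<le> 0" using u by (simp add: Z_def)
  have kpos: "k s > 0" if "s > 0" for s using that assms by (simp add: k_def rl_kernel_pos)
  define K where "K = (\<lambda>t. frac_series \<alpha> 0 (fps_X * relax_fps lam) t)"
  have int: "has_bochner_integral lborel (\<lambda>s. indicator {0<..<t} s * (k (t - s) * g s)) (K t)"
    and geq: "g t = lam * k t - lam * K t" if "t > 0" for t
    using relax_eq[OF assms(1) that] unfolding k_def g_def K_def by auto
  \<comment> \<open>The interval length \<open>\<delta>\<close> is such that \<open>\<lambda> k(u/2)\<close> times the integral of \<open>k\<close> over \<open>(0, \<delta>)\<close> is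
    less than \<open>k(u)\<close>; the bound \<open>u/2\<close> keeps \<open>k(r) \<le> k(u/2)\<close>.\<close>
  define c where "c = k u / (lam * k (u / 2) * rGamma (\<alpha> + 1))"
  have rG: "rGamma (\<alpha> + 1) > 0" using assms by (simp add: rGamma_inverse_Gamma Gamma_real_pos)
  have c: "c > 0" unfolding c_def using kpos[of u] kpos[of "u/2"] u0 rG assms by simp
  define \<delta> where "\<delta> = min (u / 2) ((c / 2) powr (1 / \<alpha>))"
  have \<delta>: "\<delta> > 0" "\<delta> \<le> u / 2" using c u0 by (auto simp: \<delta>_def)
  have "\<delta> powr \<alpha> \<le> ((c / 2) powr (1 / \<alpha>)) powr \<alpha>"
    using \<delta> assms by (intro powr_mono2) (auto simp: \<delta>_def)
  hence \<delta>c: "\<delta> powr \<alpha> < c" using assms c by (simp add: powr_powr)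
  have "compact {u - \<delta>..u}" "{u - \<delta>..u} \<noteq> {}" using \<delta> by auto
  moreover have "continuous_on {u - \<delta>..u} g"
    by (rule continuous_on_subset[OF cont]) (use \<delta> u0 in auto)
  ultimately obtain r where r: "r \<in> {u - \<delta>..u}" "\<And>s. s \<in> {u - \<delta>..u} \<Longrightarrow> g s \<le> g r"
    using continuous_attains_sup[of "{u - \<delta>..u}" g] by blast
  have gr: "g r > 0" using r(2)[of "u - \<delta>"] pos[of "u - \<delta>"] \<delta> u0 by force
  have ru: "r < u" using r(1) gr gu by (cases "r = u") auto
  have r0: "r > 0" "r \<ge> u / 2" using r \<delta> u0 by auto
  have tail: "has_bochner_integral lborel (\<lambda>s. indicator {r<..<u} s * k (u - s)) (rl_kernel (\<alpha> + 1) (u - r))"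
  proof -
    have "has_bochner_integral lborel
       (\<lambda>s. indicator {0<..<u - r} (- r + 1 * s) * (rl_kernel \<alpha> (u - r - (- r + 1 * s)) * rl_kernel 1 (- r + 1 * s)))
       (rl_kernel (\<alpha> + 1) (u - r) /\<^sub>R \<bar>1\<bar>)"
      using rl_kernel_convolution[of \<alpha> 1 "u - r"] assms ru
      by (subst lborel_has_bochner_integral_real_affine_iff[symmetric]) auto
    moreover have "indicator {0<..<u - r} (- r + 1 * s) * (rl_kernel \<alpha> (u - r - (- r + 1 * s)) * rl_kernel 1 (- r + 1 * s))
      = indicator {r<..<u} s * k (u - s)" for s
      by (cases "s \<in> {r<..<u}") (auto simp: rl_kernel_1 k_def)
    ultimately show ?thesis by simp
  qed
  have "K u \<le> k u / k r * K r + g r * rl_kernel (\<alpha> + 1) (u - r)"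
  proof -
    define F where "F = (\<lambda>s. k u / k r * (indicator {0<..<r} s * (k (r - s) * g s)) +
                      g r * (indicator {r<..<u} s * k (u - s)))"
    have F: "has_bochner_integral lborel F (k u / k r * K r + g r * rl_kernel (\<alpha> + 1) (u - r))"
      unfolding F_def by (intro has_bochner_integral_add has_bochner_integral_mult_right int r0 tail)
    have "(\<integral>s. indicator {0<..<u} s * (k (u - s) * g s) \<partial>lborel) \<le> (\<integral>s. F s \<partial>lborel)"
    proof (rule integral_mono_AE)
      show "AE s in lborel. indicator {0<..<u} s * (k (u - s) * g s) \<le> F s"
        using AE_lborel_singleton[of r]
      proof eventually_elim
        case (elim s)
        consider "s \<in> {0<..<r}" | "s \<in> {r<..<u}" | "s \<notin> {0<..<u}" using elim by force
        thus ?case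
        proof cases
          case 1
          have "k (u - s) * k r \<le> k u * k (r - s)"
            unfolding k_def using 1 ru assms by (intro rl_kernel_log_convex) auto
          hence "k (u - s) \<le> k u / k r * k (r - s)"
            using kpos[OF r0(1)] by (simp add: field_simps)
          hence "k (u - s) * g s \<le> k u / k r * k (r - s) * g s"
            using pos[of s] 1 ru by (intro mult_right_mono) auto
          thus ?thesis using 1 ru by (simp add: F_def mult_ac)
        next
          case 2
          have "g s \<le> g r" using 2 r by (intro r(2)) auto
          hence "k (u - s) * g s \<le> k (u - s) * g r"
            using kpos[of "u - s"] 2 by (intro mult_left_mono) auto
          thus ?thesis using 2 r0 by (simp add: F_def mult_ac)
        next
          case 3
          hence "s \<notin> {0<..<r}" "s \<notin> {r<..<u}" using ru r0 by auto
          thus ?thesis using 3 by (simp add: F_def)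
        qed
      qed
    qed (use F int[OF u0] in \<open>auto simp: has_bochner_integral_iff\<close>)
    thus ?thesis using F int[OF u0] by (auto simp: has_bochner_integral_iff)
  qed
  moreover have "K u = k u - g u / lam" "K r = k r - g r / lam"
    using geq[OF u0] geq[OF r0(1)] assms by (auto simp: field_simps)
  moreover have "k u / k r * (k r - g r / lam) = k u - k u * g r / (lam * k r)"
    using kpos[OF r0(1)] assms by (simp add: field_simps)
  ultimately have "k u * g r / (lam * k r) \<le> g r * rl_kernel (\<alpha> + 1) (u - r) + g u / lam"
    by simp
  moreover have "g u / lam \<le> 0" using gu assms by (simp add: divide_nonpos_pos)
  ultimately have "g r * (k u / (lam * k r)) \<le> g r * rl_kernel (\<alpha> + 1) (u - r)" by (simp add: mult_ac)
  hence "k u / (lam * k r) \<le> rl_kernel (\<alpha> + 1) (u - r)"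
    using gr by (simp only: mult_le_cancel_left_pos)
  hence "k u \<le> lam * k r * rl_kernel (\<alpha> + 1) (u - r)"
    using kpos[OF r0(1)] assms by (simp add: field_simps)
  also have "\<dots> \<le> lam * k (u / 2) * (\<delta> powr \<alpha> * rGamma (\<alpha> + 1))"
  proof (intro mult_mono mult_left_mono)
    have "r powr (\<alpha> - 1) \<le> (u / 2) powr (\<alpha> - 1)"
      using r0 u0 assms by (intro powr_mono2') auto
    thus "k r \<le> k (u / 2)"
      unfolding k_def rl_kernel_def using assms
      by (intro mult_right_mono) (auto simp: rGamma_inverse_Gamma Gamma_real_nonneg)
    have "(u - r) powr \<alpha> \<le> \<delta> powr \<alpha>" using r ru assms by (intro powr_mono2) auto
    thus "rl_kernel (\<alpha> + 1) (u - r) \<le> \<delta> powr \<alpha> * rGamma (\<alpha> + 1)"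
      unfolding rl_kernel_def using rG by (simp add: mult_right_mono)
  qed (use assms kpos[of "u/2"] kpos[of r] r0 u0 ru in \<open>auto intro!: rl_kernel_nonneg\<close>)
  also have "\<dots> < lam * k (u / 2) * (c * rGamma (\<alpha> + 1))"
    using \<delta>c rG kpos[of "u/2"] u0 assms by (intro mult_strict_left_mono mult_strict_right_mono) auto
  also have "\<dots> = k u" unfolding c_def using kpos[of "u/2"] u0 assms rG by simp
  finally show False by simp
qed

section \<open>The interarrival law\<close>

definition interarrival_fps :: "real \<Rightarrow> real fps" where
  "interarrival_fps lam = relax_fps lam ^ 2"

lemma interarrival_fps_nth_0 [simp]: "fps_nth (interarrival_fps lam) 0 = 0"
  by (simp add: interarrival_fps_def)

lemma interarrival_fps_conv_radius: "fps_conv_radius (interarrival_fps lam) > 0"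
  unfolding interarrival_fps_def by (intro fps_conv_radius_pos relax_fps_conv_radius)

lemma frac_series_mult_nonneg:
  assumes "fps_conv_radius A > 0" "fps_conv_radius B > 0" "\<alpha> > 0" "t > 0"
    "fps_nth A 0 = 0" "fps_nth B 0 = 0"
    "\<And>s. s > 0 \<Longrightarrow> frac_series \<alpha> 0 A s \<ge> 0" "\<And>s. s > 0 \<Longrightarrow> frac_series \<alpha> 0 B s \<ge> 0"
  shows "frac_series \<alpha> 0 (A * B) t \<ge> 0"
proof -
  have "has_bochner_integral lborel
    (\<lambda>s. indicator {0<..<t} s * (frac_series \<alpha> 0 A (t - s) * frac_series \<alpha> 0 B s))
    (frac_series \<alpha> (0 + 0) (A * B) t)"
    using assms by (intro frac_series_convolution) auto
  hence "frac_series \<alpha> 0 (A * B) t =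
    (\<integral>s. indicator {0<..<t} s * (frac_series \<alpha> 0 A (t - s) * frac_series \<alpha> 0 B s) \<partial>lborel)"
    by (simp add: has_bochner_integral_iff)
  also have "\<dots> \<ge> 0" using assms by (intro integral_nonneg_AE) (auto simp: indicator_def)
  finally show ?thesis .
qed

lemma interarrival_fps_nonneg:
  assumes "0 < \<alpha>" "\<alpha> \<le> 1" "lam > 0" "t > 0"
  shows "frac_series \<alpha> 0 (interarrival_fps lam) t \<ge> 0"
  unfolding interarrival_fps_def power2_eq_square using assms
  by (intro frac_series_mult_nonneg relax_fps_conv_radius less_imp_le[OF relax_pos]) auto

lemma interarrival_fps_power_nonneg:
  assumes "0 < \<alpha>" "\<alpha> \<le> 1" "lam > 0" "t > 0"
  shows "frac_series \<alpha> 0 (interarrival_fps lam ^ Suc n) t \<ge> 0"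
  using assms(4)
proof (induction n arbitrary: t)
  case 0
  thus ?case using interarrival_fps_nonneg[OF assms(1-3)] by simp
next
  case (Suc n)
  have "frac_series \<alpha> 0 (interarrival_fps lam * interarrival_fps lam ^ Suc n) t \<ge> 0"
    using assms(1-3) Suc interarrival_fps_nonneg[OF assms(1-3)]
    by (intro frac_series_mult_nonneg fps_conv_radius_pos interarrival_fps_conv_radius) auto
  thus ?case by simp
qed

text \<open>
  Multiplying by \<open>1 + \<lambda>x\<close> twice reduces the series with these coefficients first to the geometric
  series and then to 1.
\<close>
lemma interarrival_fps_nth:
  "fps_nth (interarrival_fps lam) (j + 2) = lam\<^sup>2 * (real j + 1) * (- lam) ^ j"
proof -
  define D where "D = Abs_fps (\<lambda>j. (real j + 1) * (- lam) ^ j)"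
  define Q where "Q = (1 + fps_const lam * fps_X :: real fps)"
  have G: "Q * Abs_fps (\<lambda>j. (- lam) ^ j) = 1"
    unfolding Q_def
  proof (rule fps_ext)
    fix n show "fps_nth ((1 + fps_const lam * fps_X) * Abs_fps (\<lambda>j. (- lam) ^ j)) n = fps_nth 1 n"
      by (cases n) (simp_all add: distrib_right mult.assoc)
  qed
  have "Q * D = Abs_fps (\<lambda>j. (- lam) ^ j)"
    unfolding Q_def D_def
  proof (rule fps_ext)
    fix n show "fps_nth ((1 + fps_const lam * fps_X) * Abs_fps (\<lambda>j. (real j + 1) * (- lam) ^ j)) n =
       fps_nth (Abs_fps (\<lambda>j. (- lam) ^ j)) n"
      by (cases n) (simp_all add: distrib_right mult.assoc algebra_simps)
  qed
  hence "Q * (Q * D) = 1" using G by simp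
  hence "interarrival_fps lam = interarrival_fps lam * (Q * (Q * D))" by simp
  also have "\<dots> = (Q * relax_fps lam) * (Q * relax_fps lam) * D"
    by (simp add: interarrival_fps_def power2_eq_square mult_ac)
  also have "\<dots> = fps_const (lam\<^sup>2) * (fps_X ^ 2 * D)"
    unfolding Q_def relax_fps_eq
    by (simp add: power2_eq_square mult_ac flip: fps_const_mult)
  finally show ?thesis by (simp add: D_def fps_X_power_mult_nth mult_ac)
qed

text \<open>
  Comparison of coefficients: the factor \<open>\<Gamma>(j + 2) / j!\<close> of the Mittag-Leffler function is the
  \<open>j + 1\<close> of the expansion of \<open>1 / (1 + \<lambda>x)\<^sup>2\<close>.
\<close>
lemma interarrival_density_eq:
  assumes "0 < \<alpha>"
  shows "interarrival_density lam \<alpha> t = indicator {0<..} t * frac_series \<alpha> 0 (interarrival_fps lam) t"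
proof (cases "t > 0")
  case t: True
  show ?thesis
  proof (cases "lam = 0")
    case False
    define K where "K = lam\<^sup>2 * t powr (2 * \<alpha> - 1)"
    have K: "K \<noteq> 0" using False t by (simp add: K_def)
    have 1: "fps_nth (interarrival_fps lam) 1 = 0"
      by (simp add: interarrival_fps_def power2_eq_square fps_mult_nth_1)
    have sh: "frac_series \<alpha> 0 (interarrival_fps lam) t = frac_series \<alpha> (2 * \<alpha>) (fps_shift 2 (interarrival_fps lam)) t"
      using frac_series_shift_2[OF interarrival_fps_conv_radius assms t, of lam 0] 1 by simp
    define a where "a = (\<lambda>j. Gamma (real j + 2) * (- lam * t powr \<alpha>) ^ j / (fact j * Gamma (real j * \<alpha> + 2 * \<alpha>)))"
    have "fps_nth (fps_shift 2 (interarrival_fps lam)) j * rl_kernel (\<alpha> * real j + 2 * \<alpha>) t = K * a j" for j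
    proof -
      have "Gamma (real j + 2) = fact (Suc j)"
        using Gamma_fact[of "Suc j", where 'a = real] by (simp add: add_ac)
      hence "a j = fact j * ((real j + 1) * ((- lam) ^ j * (t powr \<alpha>) ^ j)) / (fact j * Gamma (real j * \<alpha> + 2 * \<alpha>))"
        unfolding a_def power_mult_distrib by (simp add: algebra_simps)
      also have "\<dots> = (real j + 1) * ((- lam) ^ j * (t powr \<alpha>) ^ j) * rGamma (\<alpha> * real j + 2 * \<alpha>)"
        by (simp add: rGamma_inverse_Gamma divide_inverse mult.commute[of "real j"])
      finally show ?thesis
        unfolding K_def rl_kernel_power[OF t] fps_shift_nth interarrival_fps_nth by (simp add: mult_ac)
    qed
    hence "(\<lambda>j. K * a j) sums frac_series \<alpha> 0 (interarrival_fps lam) t"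
      using frac_series_sums[of "fps_shift 2 (interarrival_fps lam)" \<alpha> t "2 * \<alpha>"] interarrival_fps_conv_radius assms t
      unfolding sh by simp
    hence "a sums (frac_series \<alpha> 0 (interarrival_fps lam) t / K)"
      using sums_mult_iff[OF K, of a "frac_series \<alpha> 0 (interarrival_fps lam) t / K"] K by simp
    hence "suminf a = frac_series \<alpha> 0 (interarrival_fps lam) t / K" by (simp add: sums_iff)
    moreover have "Gamma (2::real) = 1" using Gamma_fact[of 1, where 'a = real] by simp
    hence "interarrival_density lam \<alpha> t = K * suminf a"
      using t by (simp add: interarrival_density_def mittag_leffler3_def a_def K_def)
    ultimately show ?thesis using K t by simp
  qed (use t in \<open>simp add: interarrival_density_def interarrival_fps_def relax_fps_def\<close>)
qed (simp add: interarrival_density_def)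

section \<open>The equation for formal power series\<close>

text \<open>
  At index 1 this series represents the probability that exactly \<open>n\<close> renewals have occurred: the
  difference of the distribution functions of two consecutive renewal times.
\<close>
definition count_fps :: "real \<Rightarrow> nat \<Rightarrow> real fps" where
  "count_fps lam n = (1 - interarrival_fps lam) * interarrival_fps lam ^ n"

lemma interarrival_fps_eq: "(1 + fps_const lam * fps_X)\<^sup>2 * interarrival_fps lam = fps_const (lam\<^sup>2) * fps_X ^ 2"
proof -
  have "(1 + fps_const lam * fps_X)\<^sup>2 * interarrival_fps lam = ((1 + fps_const lam * fps_X) * relax_fps lam)\<^sup>2"
    by (simp add: interarrival_fps_def power_mult_distrib)
  thus ?thesis unfolding relax_fps_eq by (simp add: power_mult_distrib fps_const_power)
qed

lemma fps_mult_nth_1_eq_0: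
  "fps_nth A 1 = 0 \<Longrightarrow> fps_nth B 1 = 0 \<Longrightarrow> fps_nth (A * B :: real fps) 1 = 0"
  by (simp add: fps_mult_nth_1)

lemma count_fps_nth_1: "fps_nth (count_fps lam n) 1 = 0"
proof -
  have 1: "fps_nth (interarrival_fps lam) 1 = 0"
    by (simp add: interarrival_fps_def power2_eq_square fps_mult_nth_1)
  have "fps_nth (interarrival_fps lam ^ n) 1 = 0" 
    by (induction n) (use 1 in \<open>auto simp: fps_mult_nth_1\<close>)
  thus ?thesis unfolding count_fps_def by (intro fps_mult_nth_1_eq_0) (use 1 in auto)
qed

lemma count_fps_conv_radius: "fps_conv_radius (count_fps lam n) > 0"
  unfolding count_fps_def by (intro fps_conv_radius_pos interarrival_fps_conv_radius) auto

text \<open>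
  The counterpart of the operator \<open>D\<^bsup>2\<alpha>\<^esup> + 2\<lambda> D\<^sup>\<alpha> + \<lambda>\<^sup>2\<close> on coefficients.
\<close>
definition telegraph_op :: "real \<Rightarrow> real fps \<Rightarrow> real fps" where
  "telegraph_op lam A = fps_shift 2 A + fps_const (2 * lam) * fps_shift 1 A + fps_const (lam\<^sup>2) * A"

lemma telegraph_op_sum:
  "telegraph_op lam (\<Sum>n\<in>I. fps_const (c n) * A n) = (\<Sum>n\<in>I. fps_const (c n) * telegraph_op lam (A n))"
  by (rule fps_ext) (simp add: telegraph_op_def fps_sum_nth sum_distrib_left sum.distrib algebra_simps)

text \<open>
  Multiplying by \<open>x\<^sup>2\<close> undoes the shifts up to initial terms, and the operator becomes multiplication
  by \<open>1 + 2\<lambda>x + \<lambda>\<^sup>2x\<^sup>2\<close>.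
\<close>
lemma X2_telegraph_op:
  assumes "fps_nth A 1 = 0"
  shows "fps_X ^ 2 * telegraph_op lam A =
    (1 + fps_const lam * fps_X)\<^sup>2 * A - fps_const (fps_nth A 0) * (1 + fps_const (2 * lam) * fps_X)"
proof -
  have 1: "fps_X * fps_shift 1 A = A - fps_const (fps_nth A 0)"
    by (rule fps_ext) (simp add: fps_X_mult_nth split: nat.split)
  have 2: "fps_X ^ 2 * fps_shift 2 A = A - fps_const (fps_nth A 0)"
  proof (rule fps_ext)
    fix n show "fps_nth (fps_X ^ 2 * fps_shift 2 A) n = fps_nth (A - fps_const (fps_nth A 0)) n"
    proof -
      consider "n = 0" | "n = 1" | k where "n = Suc (Suc k)" by (metis One_nat_def not0_implies_Suc)
      thus ?thesis by cases (use assms in \<open>auto simp: fps_X_power_mult_nth\<close>)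
    qed
  qed
  have "fps_X ^ 2 * telegraph_op lam A = fps_X ^ 2 * fps_shift 2 A +
     fps_const (2 * lam) * fps_X * (fps_X * fps_shift 1 A) + fps_const (lam\<^sup>2) * fps_X ^ 2 * A"
    by (simp add: telegraph_op_def algebra_simps power2_eq_square)
  also have "\<dots> = (1 + fps_const lam * fps_X)\<^sup>2 * A - fps_const (fps_nth A 0) * (1 + fps_const (2 * lam) * fps_X)"
    unfolding 1 2 by (simp add: power2_eq_square algebra_simps numeral_fps_const flip: fps_const_mult)
  finally show ?thesis .
qed

lemma telegraph_op_count_fps_0: "telegraph_op lam (count_fps lam 0) = 0"
proof -
  have "fps_X ^ 2 * telegraph_op lam (count_fps lam 0) =
    (1 + fps_const lam * fps_X)\<^sup>2 * (1 - interarrival_fps lam) - (1 + fps_const (2 * lam) * fps_X)"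
    using X2_telegraph_op[OF count_fps_nth_1[of lam 0], of lam] by (simp add: count_fps_def)
  also have "\<dots> = 0"
    unfolding right_diff_distrib interarrival_fps_eq
    by (simp add: power2_eq_square algebra_simps numeral_fps_const flip: fps_const_mult)
  finally show ?thesis by simp
qed

lemma telegraph_op_count_fps_Suc: "telegraph_op lam (count_fps lam (Suc n)) = fps_const (lam\<^sup>2) * count_fps lam n"
proof -
  have "fps_X ^ 2 * telegraph_op lam (count_fps lam (Suc n)) = (1 + fps_const lam * fps_X)\<^sup>2 * count_fps lam (Suc n)"
    using X2_telegraph_op[OF count_fps_nth_1[of lam "Suc n"], of lam] by (simp add: count_fps_def)
  also have "\<dots> = ((1 + fps_const lam * fps_X)\<^sup>2 * interarrival_fps lam) * count_fps lam n"
    by (simp add: count_fps_def mult_ac)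
  also have "\<dots> = fps_X ^ 2 * (fps_const (lam\<^sup>2) * count_fps lam n)"
    unfolding interarrival_fps_eq by (simp add: mult_ac)
  finally show ?thesis by simp
qed

section \<open>Renewal times and the counting process\<close>

lemma frac_series_nn_convolution:
  assumes "fps_conv_radius A > 0" "fps_conv_radius B > 0" "\<alpha> > 0"
    "fps_nth A 0 = 0" "fps_nth B 0 = 0"
    and nonneg: "\<And>s. s > 0 \<Longrightarrow> frac_series \<alpha> 0 A s \<ge> 0" "\<And>s. s > 0 \<Longrightarrow> frac_series \<alpha> 0 B s \<ge> 0"
  shows "(\<integral>\<^sup>+y. ennreal (indicator {0<..} (x - y) * frac_series \<alpha> 0 A (x - y)) *
            ennreal (indicator {0<..} y * frac_series \<alpha> 0 B y) \<partial>lborel) =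
         ennreal (indicator {0<..} x * frac_series \<alpha> 0 (A * B) x)" (is "?L = _")
proof -
  have "?L = (\<integral>\<^sup>+y. ennreal (indicator {0<..<x} y * (frac_series \<alpha> 0 A (x - y) * frac_series \<alpha> 0 B y)) \<partial>lborel)"
    by (intro nn_integral_cong) (auto simp: indicator_def nonneg simp flip: ennreal_mult')
  also have "\<dots> = ennreal (indicator {0<..} x * frac_series \<alpha> 0 (A * B) x)"
  proof (cases "x > 0")
    case True
    have *: "has_bochner_integral lborel
      (\<lambda>s. indicator {0<..<x} s * (frac_series \<alpha> 0 A (x - s) * frac_series \<alpha> 0 B s))
      (frac_series \<alpha> (0 + 0) (A * B) x)"
      using assms True by (intro frac_series_convolution) auto
    have "(\<integral>\<^sup>+y. ennreal (indicator {0<..<x} y * (frac_series \<alpha> 0 A (x - y) * frac_series \<alpha> 0 B y)) \<partial>lborel)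
      = ennreal (frac_series \<alpha> (0 + 0) (A * B) x)"
      using * nonneg by (subst nn_integral_eq_integral) (auto simp: has_bochner_integral_iff indicator_def)
    thus ?thesis using True by simp
  qed simp
  finally show ?thesis .
qed

text \<open>
  By independence the densities are convolved, and convolution at index 0 is multiplication of the
  series.
\<close>
lemma (in prob_space) distributed_partial_sum:
  fixes T :: "nat \<Rightarrow> 'a \<Rightarrow> real"
  assumes par: "0 < \<alpha>" "\<alpha> \<le> 1" "lam > 0"
    and ind: "indep_vars (\<lambda>_. borel) T {1..}"
    and dist: "\<And>k. k \<ge> 1 \<Longrightarrow> distributed M lborel (T k) (\<lambda>x. ennreal (indicator {0<..} x * frac_series \<alpha> 0 (interarrival_fps lam) x))"
  shows "distributed M lborel (\<lambda>\<omega>. \<Sum>k=1..Suc n. T k \<omega>)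
    (\<lambda>x. ennreal (indicator {0<..} x * frac_series \<alpha> 0 (interarrival_fps lam ^ Suc n) x))"
proof (induction n)
  case 0
  thus ?case using dist[of 1] by simp
next
  case (Suc n)
  have "indep_vars (\<lambda>_. borel) T (insert (Suc (Suc n)) {1..Suc n})"
    by (rule indep_vars_subset[OF ind]) auto
  hence "indep_var borel (T (Suc (Suc n))) borel (\<lambda>\<omega>. \<Sum>k\<in>{1..Suc n}. T k \<omega>)"
    by (intro indep_vars_sum) auto
  from distributed_convolution[OF this dist Suc]
  have "distributed M lborel (\<lambda>\<omega>. T (Suc (Suc n)) \<omega> + (\<Sum>k\<in>{1..Suc n}. T k \<omega>))
    (\<lambda>x. \<integral>\<^sup>+y. ennreal (indicator {0<..} (x - y) * frac_series \<alpha> 0 (interarrival_fps lam) (x - y)) *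
            ennreal (indicator {0<..} y * frac_series \<alpha> 0 (interarrival_fps lam ^ Suc n) y) \<partial>lborel)" by simp
  also have "(\<lambda>x. \<integral>\<^sup>+y. ennreal (indicator {0<..} (x - y) * frac_series \<alpha> 0 (interarrival_fps lam) (x - y)) *
            ennreal (indicator {0<..} y * frac_series \<alpha> 0 (interarrival_fps lam ^ Suc n) y) \<partial>lborel) =
     (\<lambda>x. ennreal (indicator {0<..} x * frac_series \<alpha> 0 (interarrival_fps lam * interarrival_fps lam ^ Suc n) x))"
    using interarrival_fps_nonneg[OF par] interarrival_fps_power_nonneg[OF par, of _ n] par
    by (intro ext frac_series_nn_convolution fps_conv_radius_pos interarrival_fps_conv_radius) auto
  also have "(\<lambda>\<omega>. T (Suc (Suc n)) \<omega> + (\<Sum>k\<in>{1..Suc n}. T k \<omega>)) = (\<lambda>\<omega>. \<Sum>k=1..Suc (Suc n). T k \<omega>)"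
    by (simp add: add_ac)
  finally show ?case by simp
qed

lemma (in prob_space) prob_partial_sum_le:
  fixes T :: "nat \<Rightarrow> 'a \<Rightarrow> real"
  assumes par: "0 < \<alpha>" "\<alpha> \<le> 1" "lam > 0" and t: "t > 0"
    and ind: "indep_vars (\<lambda>_. borel) T {1..}"
    and dist: "\<And>k. k \<ge> 1 \<Longrightarrow> distributed M lborel (T k) (\<lambda>x. ennreal (indicator {0<..} x * frac_series \<alpha> 0 (interarrival_fps lam) x))"
  shows "prob {\<omega> \<in> space M. (\<Sum>k=1..n. T k \<omega>) \<le> t} = frac_series \<alpha> 1 (interarrival_fps lam ^ n) t"
proof (cases n)
  case 0
  thus ?thesis using t by (simp add: prob_space rl_kernel_1)
next
  case (Suc m)
  let ?A = "interarrival_fps lam ^ Suc m"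
  let ?S = "\<lambda>\<omega>. \<Sum>k=1..Suc m. T k \<omega>"
  have A: "fps_conv_radius ?A > 0" by (intro fps_conv_radius_pos interarrival_fps_conv_radius)
  have A0: "fps_nth ?A 0 = 0" by simp
  have I: "has_bochner_integral lborel (\<lambda>s. indicator {0<..<t} s * frac_series \<alpha> 0 ?A s) (frac_series \<alpha> 1 ?A t)"
    by (rule frac_series_integral[OF A par(1) t A0])
  have nn: "0 \<le> indicator {0<..<t} s * frac_series \<alpha> 0 ?A s" for s
    using interarrival_fps_power_nonneg[OF par, of s m] by (auto simp: indicator_def)
  have "emeasure M (?S -` {..t} \<inter> space M) =
     (\<integral>\<^sup>+x. ennreal (indicator {0<..} x * frac_series \<alpha> 0 ?A x) * indicator {..t} x \<partial>lborel)"
    by (rule distributed_emeasure[OF distributed_partial_sum[OF par ind dist]]) auto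
  also have "\<dots> = (\<integral>\<^sup>+x. ennreal (indicator {0<..<t} x * frac_series \<alpha> 0 ?A x) \<partial>lborel)"
    using AE_lborel_singleton[of t] by (intro nn_integral_cong_AE) (auto simp: indicator_def elim!: eventually_mono)
  also have "\<dots> = ennreal (frac_series \<alpha> 1 ?A t)"
    using I nn by (subst nn_integral_eq_integral) (auto simp: has_bochner_integral_iff)
  finally have "emeasure M (?S -` {..t} \<inter> space M) = ennreal (frac_series \<alpha> 1 ?A t)" .
  moreover have "frac_series \<alpha> 1 ?A t \<ge> 0"
  proof -
    have "(\<integral>s. indicator {0<..<t} s * frac_series \<alpha> 0 ?A s \<partial>lborel) \<ge> 0"
      by (intro integral_nonneg_AE) (use nn in auto)
    thus ?thesis using I by (simp add: has_bochner_integral_iff)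
  qed
  ultimately have "prob (?S -` {..t} \<inter> space M) = frac_series \<alpha> 1 ?A t"
    by (simp add: measure_def)
  moreover have "?S -` {..t} \<inter> space M = {\<omega> \<in> space M. ?S \<omega> \<le> t}" by auto
  ultimately show ?thesis using Suc by simp
qed

text \<open>
  The Laplace transform \<open>c\<close> of the common law at 1 is less than 1, so Markov's inequality bounds the
  probability that the \<open>n\<close>-th partial sum stays below \<open>t\<close> by \<open>e\<^sup>t c\<^sup>n\<close>.
\<close>
lemma (in prob_space) partial_sums_exceed:
  fixes T :: "nat \<Rightarrow> 'a \<Rightarrow> real"
  assumes ind: "indep_vars (\<lambda>_. borel) T {1..}"
    and dist: "\<And>k. k \<ge> 1 \<Longrightarrow> distr M borel (T k) = distr M borel (T 1)"
    and pos: "AE \<omega> in M. T 1 \<omega> > 0"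
  shows "AE \<omega> in M. \<exists>n. (\<Sum>k=1..n. T k \<omega>) > t"
proof -
  have rv: "T k \<in> borel_measurable M" if "k \<ge> 1" for k
    using ind that unfolding indep_vars_def by auto
  have posk: "AE \<omega> in M. T k \<omega> > 0" if "k \<ge> 1" for k
  proof -
    have "AE x in distr M borel (T 1). x > 0"
      using pos rv[of 1] by (subst AE_distr_iff) auto
    hence "AE x in distr M borel (T k). x > 0" unfolding dist[OF that] .
    thus ?thesis using rv[OF that] by (subst (asm) AE_distr_iff) auto
  qed
  define c where "c = expectation (\<lambda>\<omega>. exp (- T 1 \<omega>))"
  have int: "integrable M (\<lambda>\<omega>. exp (- T k \<omega>))" if "k \<ge> 1" for k
  proof (rule integrable_const_bound[where B = 1])
    show "AE \<omega> in M. norm (exp (- T k \<omega>)) \<le> 1" using posk[OF that] by eventually_elim simp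
    show "(\<lambda>\<omega>. exp (- T k \<omega>)) \<in> borel_measurable M" using rv[OF that] by measurable
  qed
  have E: "expectation (\<lambda>\<omega>. exp (- T k \<omega>)) = c" if "k \<ge> 1" for k
  proof -
    have "expectation (\<lambda>\<omega>. exp (- T k \<omega>)) = (\<integral>x. exp (- x) \<partial>distr M borel (T k))"
      using rv[OF that] by (subst integral_distr) auto
    also have "\<dots> = c" unfolding dist[OF that] c_def using rv[of 1] by (subst integral_distr) auto
    finally show ?thesis .
  qed
  have "c < expectation (\<lambda>_. 1)"
    unfolding c_def
  proof (rule integral_less_AE_space)
    show "AE \<omega> in M. exp (- T 1 \<omega>) < 1" using pos by eventually_elim simp
  qed (use int[of 1] emeasure_space_1 in auto)
  hence c1: "c < 1" by (simp add: prob_space)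
  have c0: "c \<ge> 0" unfolding c_def by (intro integral_nonneg_AE) auto
  define S where "S = (\<lambda>n \<omega>. \<Sum>k=1..n. T k \<omega>)"
  have Sm [measurable]: "S n \<in> borel_measurable M" for n
    unfolding S_def using rv by (intro borel_measurable_sum) auto
  have intS: "integrable M (\<lambda>\<omega>. exp (- S n \<omega>))" "expectation (\<lambda>\<omega>. exp (- S n \<omega>)) = c ^ n" for n
  proof -
    have "indep_vars (\<lambda>_. borel) (\<lambda>k \<omega>. exp (- T k \<omega>)) {1..n}"
      by (rule indep_vars_compose2[OF indep_vars_subset[OF ind]]) auto
    hence "integrable M (\<lambda>\<omega>. \<Prod>k=1..n. exp (- T k \<omega>))"
      "expectation (\<lambda>\<omega>. \<Prod>k=1..n. exp (- T k \<omega>)) = (\<Prod>k=1..n. expectation (\<lambda>\<omega>. exp (- T k \<omega>)))"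
      by (intro indep_vars_integrable indep_vars_lebesgue_integral int; simp)+
    moreover have "(\<Prod>k=1..n. exp (- T k \<omega>)) = exp (- S n \<omega>)" for \<omega>
      by (simp add: S_def exp_sum sum_negf[symmetric])
    ultimately show "integrable M (\<lambda>\<omega>. exp (- S n \<omega>))" "expectation (\<lambda>\<omega>. exp (- S n \<omega>)) = c ^ n"
      by (simp_all add: E)
  qed
  define B where "B = {\<omega> \<in> space M. \<forall>n. S n \<omega> \<le> t}"
  have B [measurable]: "B \<in> events" unfolding B_def by measurable
  have bound: "prob B \<le> exp t * c ^ n" for n
  proof -
    have "prob B \<le> prob {\<omega> \<in> space M. exp (- S n \<omega>) \<ge> exp (- t)}"
      by (intro finite_measure_mono) (auto simp: B_def)
    also have "\<dots> \<le> expectation (\<lambda>\<omega>. exp (- S n \<omega>)) / exp (- t)"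
      by (rule integral_Markov_inequality_measure[where A = "{}"]) (use intS in auto)
    also have "\<dots> = exp t * c ^ n" unfolding intS(2) by (simp add: exp_minus field_simps)
    finally show ?thesis .
  qed
  have "(\<lambda>n. exp t * c ^ n) \<longlonglongrightarrow> exp t * 0"
    by (intro tendsto_mult tendsto_const LIMSEQ_power_zero) (use c0 c1 in auto)
  hence "prob B \<le> exp t * 0"
    by (rule tendsto_lowerbound) (intro always_eventually allI bound, simp)
  hence "prob B = 0" using measure_nonneg[of M B] by linarith
  hence "AE \<omega> in M. \<omega> \<notin> B" using prob_eq_0[OF B] by simp
  thus ?thesis using AE_space by eventually_elim (auto simp: B_def S_def not_le)
qed

text \<open>
  The cardinality of an infinite set is 0, hence the assumption that some partial sum exceeds \<open>t\<close>.
\<close>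
lemma card_renewals_eq_iff:
  fixes T :: "nat \<Rightarrow> real"
  assumes pos: "\<And>k. k \<ge> 1 \<Longrightarrow> T k > 0" and ex: "\<exists>n. (\<Sum>k=1..n. T k) > t" and t: "t \<ge> 0"
  shows "card {n. 1 \<le> n \<and> (\<Sum>k=1..n. T k) \<le> t} = m \<longleftrightarrow>
    (\<Sum>k=1..m. T k) \<le> t \<and> \<not> (\<Sum>k=1..Suc m. T k) \<le> t"
proof -
  define S where "S = (\<lambda>n. \<Sum>k=1..n. T k)"
  have mono: "S i \<le> S j" if "i \<le> j" for i j
    unfolding S_def by (rule sum_mono2) (use that in \<open>auto intro!: less_imp_le[OF pos]\<close>)
  define K where "K = (LEAST n. S n > t)"
  have "\<exists>n. S n > t" using ex by (simp add: S_def)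
  hence K: "S K > t" unfolding K_def by (rule LeastI_ex)
  have lt: "S n \<le> t \<longleftrightarrow> n < K" for n
  proof
    assume "S n \<le> t"
    hence "\<not> K \<le> n" using mono[of K n] K by linarith
    thus "n < K" by simp
  next
    assume "n < K"
    thus "S n \<le> t" using not_less_Least[of n "\<lambda>n. S n > t"] unfolding K_def by linarith
  qed
  have "S 0 \<le> t" using t by (simp add: S_def)
  hence "K > 0" using lt by blast
  have "{n. 1 \<le> n \<and> S n \<le> t} = {1..<K}" by (auto simp: lt)
  hence "card {n. 1 \<le> n \<and> S n \<le> t} = K - 1" by simp
  moreover have "K - 1 = m \<longleftrightarrow> m < K \<and> \<not> Suc m < K" using \<open>K > 0\<close> by auto
  ultimately show ?thesis using lt[of m] lt[of "Suc m"] unfolding S_def by simp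
qed

text \<open>
  Almost surely, \<open>n\<close> renewals have occurred at time \<open>t\<close> iff the \<open>n\<close>-th renewal time is at most \<open>t\<close> and
  the next one is not.
\<close>
lemma (in prob_space) prob_renewal_count:
  assumes par: "0 < \<alpha>" "\<alpha> \<le> 1" "lam > 0" and t: "t > 0"
    and N: "renewal_counting_process M (interarrival_density lam \<alpha>) N"
    and meas: "{\<omega> \<in> space M. N t \<omega> = n} \<in> events"
  shows "prob {\<omega> \<in> space M. N t \<omega> = n} = frac_series \<alpha> 1 (count_fps lam n) t"
proof -
  obtain T :: "nat \<Rightarrow> 'a \<Rightarrow> real" where ind: "indep_vars (\<lambda>_. borel) T {1..}"
    and dist': "\<And>k. k \<ge> 1 \<Longrightarrow> distributed M lborel (T k) (\<lambda>x. ennreal (interarrival_density lam \<alpha> x))"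
    and NT: "AE \<omega> in M. \<forall>t\<ge>0. N t \<omega> = card {n. 1 \<le> n \<and> (\<Sum>k=1..n. T k \<omega>) \<le> t}"
    using N unfolding renewal_counting_process_def by blast
  have dist: "distributed M lborel (T k) (\<lambda>x. ennreal (indicator {0<..} x * frac_series \<alpha> 0 (interarrival_fps lam) x))" if "k \<ge> 1" for k
    using dist'[OF that] by (simp add: interarrival_density_eq[OF par(1)])
  have rv: "T k \<in> borel_measurable M" if "k \<ge> 1" for k
    using ind that unfolding indep_vars_def by auto
  have pos: "AE \<omega> in M. T k \<omega> > 0" if "k \<ge> 1" for k
  proof -
    have "emeasure M (T k -` {..0} \<inter> space M) =
      (\<integral>\<^sup>+x. ennreal (indicator {0<..} x * frac_series \<alpha> 0 (interarrival_fps lam) x) * indicator {..0} x \<partial>lborel)"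
      by (rule distributed_emeasure[OF dist[OF that]]) auto
    also have "\<dots> = (\<integral>\<^sup>+(x::real). 0 \<partial>lborel)"
      by (intro nn_integral_cong) (auto simp: indicator_def)
    finally have "T k -` {..0} \<inter> space M \<in> null_sets M"
      using rv[OF that] by (intro null_setsI) auto
    thus ?thesis by (rule AE_I') auto
  qed
  have dd: "distr M borel (T k) = distr M borel (T 1)" if "k \<ge> 1" for k
  proof -
    have "distr M lborel (T k) = distr M lborel (T 1)"
      using distributed_distr_eq_density[OF dist[OF that]] distributed_distr_eq_density[OF dist[of 1]] by simp
    moreover have "distr M lborel (T j) = distr M borel (T j)" for j
      by (intro distr_cong) auto
    ultimately show ?thesis by simp
  qed
  let ?S = "\<lambda>n \<omega>. \<Sum>k=1..n. T k \<omega>"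
  have Sm [measurable]: "?S n \<in> borel_measurable M" for n
    using rv by (intro borel_measurable_sum) auto
  define A where "A = (\<lambda>n. {\<omega> \<in> space M. ?S n \<omega> \<le> t})"
  have A [measurable]: "A n \<in> events" for n unfolding A_def by measurable
  have PA: "prob (A n) = frac_series \<alpha> 1 (interarrival_fps lam ^ n) t" for n
    unfolding A_def by (rule prob_partial_sum_le[OF par t ind dist])
  have posall: "AE \<omega> in M. \<forall>k\<in>{1..}. T k \<omega> > 0"
    by (subst AE_ball_countable) (auto intro: pos)
  have exceed: "AE \<omega> in M. \<exists>n. ?S n \<omega> > t"
    by (rule partial_sums_exceed[OF ind], erule dd, rule pos, rule order.refl)
  have "prob {\<omega> \<in> space M. N t \<omega> = n} = prob (A n - A (Suc n))"
  proof (rule measure_eq_AE[OF _ meas])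
    show "AE \<omega> in M. (\<omega> \<in> {\<omega> \<in> space M. N t \<omega> = n}) = (\<omega> \<in> A n - A (Suc n))"
      using NT posall exceed AE_space
    proof eventually_elim
      case (elim \<omega>)
      have "N t \<omega> = card {n. 1 \<le> n \<and> ?S n \<omega> \<le> t}" using elim(1) t by simp
      moreover have "card {n. 1 \<le> n \<and> ?S n \<omega> \<le> t} = n \<longleftrightarrow> ?S n \<omega> \<le> t \<and> \<not> ?S (Suc n) \<omega> \<le> t"
        using elim t by (intro card_renewals_eq_iff) auto
      ultimately show ?case using elim(4) by (auto simp: A_def)
    qed
  qed auto
  also have "\<dots> = prob (A n) - prob (A n \<inter> A (Suc n))"
    by (rule finite_measure_Diff') auto
  also have "prob (A n \<inter> A (Suc n)) = prob (A (Suc n))"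
  proof (rule measure_eq_AE)
    show "AE \<omega> in M. (\<omega> \<in> A n \<inter> A (Suc n)) = (\<omega> \<in> A (Suc n))"
      using pos[of "Suc n"] by (auto simp: A_def elim!: eventually_mono)
  qed auto
  also have "prob (A n) - prob (A (Suc n)) = frac_series \<alpha> 1 (interarrival_fps lam ^ n - interarrival_fps lam ^ Suc n) t"
    unfolding PA using par t
    by (intro frac_series_diff[symmetric] fps_conv_radius_pos interarrival_fps_conv_radius) auto
  also have "interarrival_fps lam ^ n - interarrival_fps lam ^ Suc n = count_fps lam n"
    by (simp add: count_fps_def algebra_simps)
  finally show ?thesis .
qed

section \<open>The compound process\<close>

text \<open>
  Condition on the jump that is added last; it is independent of the others and distributed like the
  first one.
\<close>
lemma (in prob_space) prob_sum_Suc_eq: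
  fixes X :: "nat \<Rightarrow> 'a \<Rightarrow> nat"
  assumes ind: "indep_vars (\<lambda>_. count_space UNIV) X {1..}"
    and dist: "\<And>i. i \<ge> 1 \<Longrightarrow> distr M (count_space UNIV) (X i) = distr M (count_space UNIV) (X 1)"
    and X1: "\<And>i \<omega>. i \<ge> 1 \<Longrightarrow> \<omega> \<in> space M \<Longrightarrow> X i \<omega> \<ge> 1"
  shows "prob {\<omega> \<in> space M. (\<Sum>i=1..Suc n. X i \<omega>) = m} =
    (\<Sum>j=1..m. prob {\<omega> \<in> space M. X 1 \<omega> = j} * prob {\<omega> \<in> space M. (\<Sum>i=1..n. X i \<omega>) = m - j})"
proof -
  have rv: "X k \<in> measurable M (count_space UNIV)" if "k \<ge> 1" for k
    using ind that unfolding indep_vars_def by auto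
  let ?Y = "X (Suc n)" and ?S = "\<lambda>\<omega>. \<Sum>i=1..n. X i \<omega>"
  have "indep_vars (\<lambda>_. borel) (\<lambda>i \<omega>. real (X i \<omega>)) {1..}"
    by (rule indep_vars_compose2[OF ind]) auto
  hence "indep_vars (\<lambda>_. borel) (\<lambda>i \<omega>. real (X i \<omega>)) (insert (Suc n) {1..n})"
    by (rule indep_vars_subset) auto
  hence "indep_var borel (\<lambda>\<omega>. real (?Y \<omega>)) borel (\<lambda>\<omega>. \<Sum>i\<in>{1..n}. real (X i \<omega>))"
    by (intro indep_vars_sum) auto
  hence iv: "indep_var borel (\<lambda>\<omega>. real (?Y \<omega>)) borel (\<lambda>\<omega>. real (?S \<omega>))" by simp
  have prod: "prob {\<omega> \<in> space M. ?Y \<omega> = j \<and> ?S \<omega> = k} =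
      prob {\<omega> \<in> space M. X 1 \<omega> = j} * prob {\<omega> \<in> space M. ?S \<omega> = k}" for j k
  proof -
    have "prob ((\<lambda>\<omega>. (real (?Y \<omega>), real (?S \<omega>))) -` ({real j} \<times> {real k}) \<inter> space M) =
      prob ((\<lambda>\<omega>. real (?Y \<omega>)) -` {real j} \<inter> space M) * prob ((\<lambda>\<omega>. real (?S \<omega>)) -` {real k} \<inter> space M)"
      by (rule indep_varD[OF iv]) auto
    moreover have "(\<lambda>\<omega>. (real (?Y \<omega>), real (?S \<omega>))) -` ({real j} \<times> {real k}) \<inter> space M =
       {\<omega> \<in> space M. ?Y \<omega> = j \<and> ?S \<omega> = k}"
      by (auto simp del: of_nat_sum)
    moreover have "(\<lambda>\<omega>. real (?Y \<omega>)) -` {real j} \<inter> space M = ?Y -` {j} \<inter> space M"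
       by auto
    moreover have "(\<lambda>\<omega>. real (?S \<omega>)) -` {real k} \<inter> space M = {\<omega> \<in> space M. ?S \<omega> = k}"
      by (auto simp del: of_nat_sum)
    moreover have "prob (?Y -` {j} \<inter> space M) = prob {\<omega> \<in> space M. X 1 \<omega> = j}"
    proof -
      have "prob (?Y -` {j} \<inter> space M) = measure (distr M (count_space UNIV) ?Y) {j}"
        using rv[of "Suc n"] by (subst measure_distr) auto
      also have "\<dots> = measure (distr M (count_space UNIV) (X 1)) {j}" by (subst dist) auto
      also have "\<dots> = prob (X 1 -` {j} \<inter> space M)" using rv[of 1] by (subst measure_distr) auto
      also have "X 1 -` {j} \<inter> space M = {\<omega> \<in> space M. X 1 \<omega> = j}" by auto
      finally show ?thesis .
    qed
    ultimately show ?thesis by simp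
  qed
  have Sm: "?S \<in> measurable M (count_space UNIV)"
    using rv by (intro measurable_sum_nat) auto
  have "{\<omega> \<in> space M. (\<Sum>i=1..Suc n. X i \<omega>) = m} =
     (\<Union>j\<in>{1..m}. {\<omega> \<in> space M. ?Y \<omega> = j \<and> ?S \<omega> = m - j})" (is "?L = ?R")
  proof (rule set_eqI)
    fix \<omega> show "\<omega> \<in> ?L \<longleftrightarrow> \<omega> \<in> ?R" using X1[of "Suc n" \<omega>] by auto
  qed
  also have "prob \<dots> = (\<Sum>j=1..m. prob {\<omega> \<in> space M. ?Y \<omega> = j \<and> ?S \<omega> = m - j})"
  proof (rule finite_measure_finite_Union)
    show "(\<lambda>j. {\<omega> \<in> space M. ?Y \<omega> = j \<and> ?S \<omega> = m - j}) ` {1..m} \<subseteq> events"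
      using rv[of "Suc n"] Sm by auto
  qed (auto simp: disjoint_family_on_def)
  finally show ?thesis by (simp only: prod)
qed

text \<open>
  Condition on the number of jumps, which is at most \<open>m\<close> since every jump has size at least one. This
  makes the total probability formula a finite sum.
\<close>
lemma (in prob_space) state_prob_compound:
  fixes X :: "nat \<Rightarrow> 'a \<Rightarrow> nat" and N :: "real \<Rightarrow> 'a \<Rightarrow> nat"
  assumes t: "t \<ge> 0"
    and X1: "\<And>i \<omega>. i \<ge> 1 \<Longrightarrow> \<omega> \<in> space M \<Longrightarrow> X i \<omega> \<ge> 1"
    and ind: "indep_set (generated_events M X {1..}) (generated_events M N {0..})"
  shows "{\<omega> \<in> space M. N t \<omega> = n} \<in> events"
    and "state_prob M (compound_process N X) m t =
      (\<Sum>n\<le>m. prob {\<omega> \<in> space M. (\<Sum>i=1..n. X i \<omega>) = m} * prob {\<omega> \<in> space M. N t \<omega> = n})"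
proof -
  have sub: "generated_events M X {1..} \<subseteq> events" "generated_events M N {0..} \<subseteq> events"
    using indep_setD_ev1[OF ind] indep_setD_ev2[OF ind] by auto
  have gN: "{\<omega> \<in> space M. N t \<omega> = n} \<in> generated_events M N {0..}" for n
  proof -
    have "N t -` {n} \<inter> space M \<in> generated_events M N {0..}"
      unfolding generated_events_def by (rule sigma_sets.Basic) (use t in auto)
    moreover have "N t -` {n} \<inter> space M = {\<omega> \<in> space M. N t \<omega> = n}" by auto
    ultimately show ?thesis by simp
  qed
  thus meas: "{\<omega> \<in> space M. N t \<omega> = n} \<in> events" for n using sub by blast
  have gX: "{\<omega> \<in> space M. (\<Sum>i=1..n. X i \<omega>) = m} \<in> generated_events M X {1..}" for n
  proof -
    define G where "G = sigma (space M) {X i -` A \<inter> space M | i A. i \<in> {1..}}"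
    have sp: "space G = space M" unfolding G_def by (rule space_measure_of) auto
    have sG: "sets G = generated_events M X {1..}"
      unfolding G_def generated_events_def by (rule sets_measure_of) auto
    have "X i \<in> measurable G (count_space UNIV)" if "i \<ge> 1" for i
    proof (rule measurableI)
      fix A :: "nat set"
      show "X i -` A \<inter> space G \<in> sets G"
        unfolding sp sG generated_events_def by (rule sigma_sets.Basic) (use that in auto)
    qed simp
    hence "(\<lambda>\<omega>. \<Sum>i=1..n. X i \<omega>) \<in> measurable G (count_space UNIV)"
      by (intro measurable_sum_nat) auto
    hence "(\<lambda>\<omega>. \<Sum>i=1..n. X i \<omega>) -` {m} \<inter> space G \<in> sets G" by (rule measurable_sets) auto
    moreover have "(\<lambda>\<omega>. \<Sum>i=1..n. X i \<omega>) -` {m} \<inter> space G = {\<omega> \<in> space M. (\<Sum>i=1..n. X i \<omega>) = m}"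
      unfolding sp by auto
    ultimately show ?thesis unfolding sG by simp
  qed
  have ge: "(\<Sum>i=1..n. X i \<omega>) \<ge> n" if "\<omega> \<in> space M" for n \<omega>
    using sum_mono[of "{1..n}" "\<lambda>_. 1" "\<lambda>i. X i \<omega>"] X1[OF _ that] by auto
  have "{\<omega> \<in> space M. compound_process N X t \<omega> = m} =
    (\<Union>n\<in>{..m}. {\<omega> \<in> space M. (\<Sum>i=1..n. X i \<omega>) = m} \<inter> {\<omega> \<in> space M. N t \<omega> = n})"
    using ge by (fastforce simp: compound_process_def)
  hence "state_prob M (compound_process N X) m t =
    prob (\<Union>n\<in>{..m}. {\<omega> \<in> space M. (\<Sum>i=1..n. X i \<omega>) = m} \<inter> {\<omega> \<in> space M. N t \<omega> = n})"
    by (simp add: state_prob_def)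
  also have "\<dots> = (\<Sum>n\<le>m. prob ({\<omega> \<in> space M. (\<Sum>i=1..n. X i \<omega>) = m} \<inter> {\<omega> \<in> space M. N t \<omega> = n}))"
  proof (rule finite_measure_finite_Union)
    show "(\<lambda>n. {\<omega> \<in> space M. (\<Sum>i=1..n. X i \<omega>) = m} \<inter> {\<omega> \<in> space M. N t \<omega> = n}) ` {..m} \<subseteq> events"
      using gX gN sub by blast
  qed (auto simp: disjoint_family_on_def)
  also have "\<dots> = (\<Sum>n\<le>m. prob {\<omega> \<in> space M. (\<Sum>i=1..n. X i \<omega>) = m} * prob {\<omega> \<in> space M. N t \<omega> = n})"
    by (intro sum.cong refl indep_setD[OF ind] gX gN)
  finally show "state_prob M (compound_process N X) m t = \<dots>" .
qed

theorem proposition4p1: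
  fixes M :: "'a measure"
    and N :: "real \<Rightarrow> 'a \<Rightarrow> nat"
    and X :: "nat \<Rightarrow> 'a \<Rightarrow> nat"
    and lam \<alpha> :: real
  assumes "prob_space M"
    and "lam > 0" and "0 < \<alpha>" and "\<alpha> \<le> 1"
    and "renewal_counting_process M (interarrival_density lam \<alpha>) N"
    and "prob_space.indep_vars M (\<lambda>_. count_space UNIV) X {1..}"
    and "\<And>i. i \<ge> 1 \<Longrightarrow> distr M (count_space UNIV) (X i) = distr M (count_space UNIV) (X 1)"
    and "\<And>i \<omega>. i \<ge> 1 \<Longrightarrow> \<omega> \<in> space M \<Longrightarrow> X i \<omega> \<ge> 1"
    and "integrable M (\<lambda>\<omega>. real (X 1 \<omega>))"
    and "integrable M (\<lambda>\<omega>. (real (X 1 \<omega>))\<^sup>2)"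
    and "prob_space.indep_set M (generated_events M X {1..}) (generated_events M N {0..})"
  shows "(\<forall>m. \<forall>t>0. caputo_differentiable (2 * \<alpha>) (state_prob M (compound_process N X) m) t \<and>
                    caputo_differentiable \<alpha> (state_prob M (compound_process N X) m) t) \<and>
    (\<forall>t>0. caputo_deriv (2 * \<alpha>) (state_prob M (compound_process N X) 0) t
             + 2 * lam * caputo_deriv \<alpha> (state_prob M (compound_process N X) 0) t
           = - lam\<^sup>2 * state_prob M (compound_process N X) 0 t) \<and>
    (\<forall>m\<ge>1. \<forall>t>0. caputo_deriv (2 * \<alpha>) (state_prob M (compound_process N X) m) t
             + 2 * lam * caputo_deriv \<alpha> (state_prob M (compound_process N X) m) t
           = - lam\<^sup>2 * (state_prob M (compound_process N X) m t
               - (\<Sum>j=1..m. measure M {\<omega> \<in> space M. X 1 \<omega> = j}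
                              * state_prob M (compound_process N X) (m - j) t)))"
proof -
  interpret prob_space M by fact
  note par = assms(3,4,2)
  define p where "p = state_prob M (compound_process N X)"
  define r where "r = (\<lambda>j. prob {\<omega> \<in> space M. X 1 \<omega> = j})"
  define q where "q = (\<lambda>n m. prob {\<omega> \<in> space M. (\<Sum>i=1..n. X i \<omega>) = m})"
  define B where "B = (\<lambda>m. \<Sum>n\<le>m. fps_const (q n m) * count_fps lam n)"
  have conv: "fps_conv_radius (B m) > 0" for m
    unfolding B_def by (intro fps_conv_radius_pos count_fps_conv_radius) simp
  have B1: "fps_nth (B m) 1 = 0" for m
    unfolding B_def using count_fps_nth_1[of lam] by (simp add: fps_sum_nth)
  have p: "p m t = frac_series \<alpha> 1 (B m) t" if t: "t > 0" for m t
  proof -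
    have "p m t = (\<Sum>n\<le>m. q n m * prob {\<omega> \<in> space M. N t \<omega> = n})"
      unfolding p_def q_def using t by (intro state_prob_compound(2)[OF _ assms(8,11)]) auto
    also have "\<dots> = (\<Sum>n\<le>m. q n m * frac_series \<alpha> 1 (count_fps lam n) t)"
      using state_prob_compound(1)[OF _ assms(8,11), of t] t
      by (intro sum.cong refl arg_cong2[where f = "(*)"] prob_renewal_count par assms(5)) auto
    also have "\<dots> = (\<Sum>n\<le>m. frac_series \<alpha> 1 (fps_const (q n m) * count_fps lam n) t)"
      using t par by (simp add: frac_series_cmult count_fps_conv_radius)
    also have "\<dots> = frac_series \<alpha> 1 (B m) t"
      unfolding B_def using t par
      by (intro frac_series_sum[symmetric] fps_conv_radius_pos count_fps_conv_radius) auto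
    finally show ?thesis .
  qed
  have q0: "q n m = 0" if "m < n" for n m
  proof -
    have "(\<Sum>i=1..n. X i \<omega>) \<ge> n" if "\<omega> \<in> space M" for \<omega>
      using sum_mono[of "{1..n}" "\<lambda>_. 1" "\<lambda>i. X i \<omega>"] assms(8)[OF _ that] by auto
    hence "{\<omega> \<in> space M. (\<Sum>i=1..n. X i \<omega>) = m} = {}" using that by force
    thus ?thesis unfolding q_def by (simp only: measure_empty)
  qed
  have qSuc: "q (Suc n) m = (\<Sum>j=1..m. r j * q n (m - j))" for n m
    unfolding q_def r_def
    by (rule prob_sum_Suc_eq[OF assms(6)], erule assms(7), erule (1) assms(8))
  have telegraph_B: "telegraph_op lam (B m) = fps_const (lam\<^sup>2) * (\<Sum>j=1..m. fps_const (r j) * B (m - j))" for m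
  proof -
    \<comment> \<open>Apply the operator to each summand; this lowers the number of jumps by one, and the
      recursion for the jump sums then splits off the size \<open>j\<close> of one jump.\<close>
    have "telegraph_op lam (B m) = (\<Sum>n\<le>m. fps_const (q n m) * telegraph_op lam (count_fps lam n))"
      unfolding B_def by (rule telegraph_op_sum)
    also have "\<dots> = (\<Sum>n<m. fps_const (q (Suc n) m) * (fps_const (lam\<^sup>2) * count_fps lam n))"
      by (subst sum.atMost_shift) (simp add: telegraph_op_count_fps_0 telegraph_op_count_fps_Suc)
    also have "\<dots> = (\<Sum>n<m. \<Sum>j=1..m. fps_const (lam\<^sup>2) * (fps_const (r j) * (fps_const (q n (m - j)) * count_fps lam n)))"
      unfolding qSuc
      by (intro sum.cong refl fps_ext) (simp add: fps_sum_nth sum_distrib_left sum_distrib_right mult_ac)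
    also have "\<dots> = (\<Sum>j=1..m. fps_const (lam\<^sup>2) * (fps_const (r j) * (\<Sum>n<m. fps_const (q n (m - j)) * count_fps lam n)))"
      by (subst sum.swap) (simp add: sum_distrib_left)
    also have "\<dots> = (\<Sum>j=1..m. fps_const (lam\<^sup>2) * (fps_const (r j) * B (m - j)))"
    proof (intro sum.cong refl arg_cong2[where f = "(*)"])
      fix j assume j: "j \<in> {1..m}"
      show "(\<Sum>n<m. fps_const (q n (m - j)) * count_fps lam n) = B (m - j)"
        unfolding B_def by (rule sum.mono_neutral_right) (use j q0 in auto)
    qed
    finally show ?thesis by (simp add: sum_distrib_left)
  qed
  have cap: "caputo_differentiable (2 * \<alpha>) (p m) t" "caputo_differentiable \<alpha> (p m) t"
    "caputo_deriv (2 * \<alpha>) (p m) t = frac_series \<alpha> 1 (fps_shift 2 (B m)) t"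
    "caputo_deriv \<alpha> (p m) t = frac_series \<alpha> 1 (fps_shift 1 (B m)) t" if "t > 0" for m t
    using caputo_2_frac_series[OF conv par(1,2) B1 p that] caputo_frac_series[OF conv par(1,2) p that] by auto
  have main: "caputo_deriv (2 * \<alpha>) (p m) t + 2 * lam * caputo_deriv \<alpha> (p m) t =
      - lam\<^sup>2 * (p m t - (\<Sum>j=1..m. r j * p (m - j) t))" if t: "t > 0" for m t
  proof -
    note [simp] = frac_series_add frac_series_cmult frac_series_sum conv par t fps_conv_radius_pos
    have "frac_series \<alpha> 1 (telegraph_op lam (B m)) t =
       caputo_deriv (2 * \<alpha>) (p m) t + 2 * lam * caputo_deriv \<alpha> (p m) t + lam\<^sup>2 * p m t"
      unfolding telegraph_op_def by (simp add: cap p)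
    moreover have "frac_series \<alpha> 1 (telegraph_op lam (B m)) t = lam\<^sup>2 * (\<Sum>j=1..m. r j * p (m - j) t)"
      unfolding telegraph_B by (simp add: p)
    ultimately show ?thesis by (simp add: algebra_simps)
  qed
  show ?thesis
    using cap main main[of _ 0] unfolding p_def r_def by auto
qed

end
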